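(* Let $\mathbb{F}$ be a field of characteristic not $2$. Every $6$-dimensional nilpotent non-Malcev binary Lie algebra over $\mathbb{F}$ is isomorphic to one of the following algebras with basis $e_1,\dots,e_6$: - $\mathbf{B}_{6,1}^{\alpha}$ ($\alpha\in\mathbb{F}$): $[e_{1},e_{2}]=e_{4}$, $[e_{1},e_{3}]=e_{5}$, $[e_{2},e_{3}]=\alpha e_{6}$, $[e_{4},e_{5}]=e_{6}$; - $\mathbf{B}_{6,2}$: $[e_{1},e_{2}]=e_{3}$, $[e_{3},e_{4}]=e_{5}$, $[e_{4},e_{5}]=e_{6}$; - $\mathbf{B}_{6,3}$: $[e_{1},e_{2}]=e_{3}$, $[e_{3},e_{4}]=e_{5}$, $[e_{1},e_{3}]=e_{6}$, $[e_{4},e_{5}]=e_{6}$. Among these algebras there are precisely the following isomorphisms: $\mathbf{B}_{6,1}^{\alpha}\cong\mathbf{B}_{6,1}^{\beta}$ if and only if there is a $\lambda\in\mathbb{F}^{\ast}$ such that $\beta=\lambda^{2}\alpha$.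
   Context: An algebra is a vector space with a bilinear product $[-,-]$, not assumed associative. It is anticommutative if $[x,x]=0$ for all $x$. The multiplication of an anticommutative algebra is specified by giving only the nonzero products among basis elements (products $[e_j,e_i]=-[e_i,e_j]$ are understood, and all other products of basis elements are zero). In an anticommutative algebra $A$ the Jacobian is $\mathcal{J}(x,y,z):=[[x,y],z]+[[y,z],x]+[[z,x],y]$. An anticommutative algebra $A$ is a Malcev algebra if $\mathcal{J}(x,y,[x,z])=[\mathcal{J}(x,y,z),x]$ for all $x,y,z\in A$, and a binary Lie algebra if $\mathcal{J}([x,y],x,y)=0$ for all $x,y\in A$. "Non-Malcev" means not a Malcev algebra. Set $A^{1}=A$ and $A^{n+1}=[A^{n},A^{1}]+[A^{n-1},A^{2}]+\cdots+[A^{1},A^{n}]$; $A$ is nilpotent if $A^{n}=0$ for some $n$. *)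

theory Defs
  imports "HOL-Analysis.Analysis"
begin

locale nonassoc_algebra = vector_space scale
  for scale :: "'a::field \<Rightarrow> 'b::ab_group_add \<Rightarrow> 'b" +
  fixes br :: "'b \<Rightarrow> 'b \<Rightarrow> 'b"
  assumes linear_left: "Vector_Spaces.linear scale scale (\<lambda>x. br x y)"
    and linear_right: "Vector_Spaces.linear scale scale (\<lambda>y. br x y)"
begin

text \<open>
  The descending powers of the algebra, indexed from 1; the value at 0 is irrelevant.
  The sum of the subspaces \<open>[A\<^sup>n\<^sup>-\<^sup>i, A\<^sup>i]\<close>, \<open>1 \<le> i < n\<close>, is the span of the union of the
  sets of products.
\<close>
fun alg_power :: "nat \<Rightarrow> 'b set" where
  "alg_power n =
     (if n \<le> 1 then UNIV
      else span (\<Union>i\<in>{1..<n}. {br x y | x y. x \<in> alg_power (n - i) \<and> y \<in> alg_power i}))"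

declare alg_power.simps [simp del]

definition nilpotent :: bool where
  "nilpotent \<longleftrightarrow> (\<exists>n\<ge>1. alg_power n = {0})"

definition jacobian :: "'b \<Rightarrow> 'b \<Rightarrow> 'b \<Rightarrow> 'b" where
  "jacobian x y z = br (br x y) z + br (br y z) x + br (br z x) y"

end

locale anticommutative_algebra = nonassoc_algebra +
  assumes br_self: "br x x = 0"

locale malcev_algebra = anticommutative_algebra +
  assumes malcev: "jacobian x y (br x z) = br (jacobian x y z) x"

locale binary_lie_algebra = anticommutative_algebra +
  assumes binary_lie: "jacobian (br x y) x y = 0"

definition alg_isomorphic ::
  "('a::field \<Rightarrow> 'b::ab_group_add \<Rightarrow> 'b) \<Rightarrow> ('b \<Rightarrow> 'b \<Rightarrow> 'b) \<Rightarrow>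
   ('a \<Rightarrow> 'c::ab_group_add \<Rightarrow> 'c) \<Rightarrow> ('c \<Rightarrow> 'c \<Rightarrow> 'c) \<Rightarrow> bool" where
  "alg_isomorphic s1 br1 s2 br2 \<longleftrightarrow>
     (\<exists>f. Vector_Spaces.linear s1 s2 f \<and> bij f \<and> (\<forall>x y. f (br1 x y) = br2 (f x) (f y)))"

abbreviation evec :: "6 \<Rightarrow> 'a::field ^ 6" where
  "evec i \<equiv> axis i 1"

text \<open>
  The anticommutative bilinear product given by a table \<open>t\<close> of products of basis vectors that lists
  each unordered pair of distinct indices in at most one order and is 0 elsewhere: then
  \<open>[e\<^sub>i, e\<^sub>j] = t i j = - [e\<^sub>j, e\<^sub>i]\<close> for each listed pair \<open>(i, j)\<close>.
\<close>
definition table_product ::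
  "(6 \<Rightarrow> 6 \<Rightarrow> 'a::field ^ 6) \<Rightarrow> 'a ^ 6 \<Rightarrow> 'a ^ 6 \<Rightarrow> 'a ^ 6" where
  "table_product t x y = (\<Sum>i\<in>UNIV. \<Sum>j\<in>UNIV. (x $ i * y $ j) *s (t i j - t j i))"

text \<open>The index type \<open>6\<close> is the integers modulo 6, so its elements are \<open>1, \<dots>, 6\<close> (with \<open>6 = 0\<close>).\<close>

definition B61 :: "'a::field \<Rightarrow> 'a ^ 6 \<Rightarrow> 'a ^ 6 \<Rightarrow> 'a ^ 6" where
  "B61 \<alpha> = table_product (\<lambda>i j.
     if (i, j) = (1, 2) then evec 4
     else if (i, j) = (1, 3) then evec 5
     else if (i, j) = (2, 3) then \<alpha> *s evec 6
     else if (i, j) = (4, 5) then evec 6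
     else 0)"

definition B62 :: "'a::field ^ 6 \<Rightarrow> 'a ^ 6 \<Rightarrow> 'a ^ 6" where
  "B62 = table_product (\<lambda>i j.
     if (i, j) = (1, 2) then evec 3
     else if (i, j) = (3, 4) then evec 5
     else if (i, j) = (4, 5) then evec 6
     else 0)"

definition B63 :: "'a::field ^ 6 \<Rightarrow> 'a ^ 6 \<Rightarrow> 'a ^ 6" where
  "B63 = table_product (\<lambda>i j.
     if (i, j) = (1, 2) then evec 3
     else if (i, j) = (3, 4) then evec 5
     else if (i, j) = (1, 3) then evec 6
     else if (i, j) = (4, 5) then evec 6
     else 0)"

end

theory Submission
  imports Defs
begin

text \<open>
  Let \<open>L\<^sub>0 = A \<supseteq> L\<^sub>1 = [A, A] \<supseteq> L\<^sub>2 \<supseteq> \<dots>\<close> be the lower central series, \<open>L\<^sub>n\<^sub>+\<^sub>1 = [L\<^sub>n, A]\<close>; it decreases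
  strictly until it vanishes. If \<open>dim A/L\<^sub>1 = 2\<close>, consequences of the linearized binary Lie identity,
  above all \<open>J(x, y, [x, z]) = - J(x, z, [x, y])\<close>, show that the Jacobian vanishes, so \<open>A\<close> is a Lie
  algebra. If \<open>L\<^sub>3 = 0\<close>, then \<open>J(x, y, [x, z]) = [[x, y], [x, z]]\<close> and \<open>[J(x, y, z), x] = 0\<close>, so \<open>A\<close> is
  Malcev when \<open>[L\<^sub>1, L\<^sub>1] = 0\<close>, in particular when \<open>dim L\<^sub>1/L\<^sub>2 \<le> 1\<close>. Only the dimension sequences
  \<open>6 > 3 > 1 > 0\<close> and \<open>6 > 3 > 2 > 1 > 0\<close> survive.

  In the first case the product induces a nondegenerate alternating form on \<open>L\<^sub>1/L\<^sub>2\<close> with values in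
  \<open>L\<^sub>2\<close>. Some two of the three generators commute modulo \<open>L\<^sub>2\<close>, and by nondegeneracy the generators
  can be corrected by elements of \<open>L\<^sub>1\<close> so that they annihilate \<open>L\<^sub>1\<close>; this is \<open>B\<^sub>6\<^sub>,\<^sub>1\<close>. In the second
  case the alternating form on \<open>A/L\<^sub>1\<close> with values in \<open>L\<^sub>1/L\<^sub>2\<close> has a one-dimensional radical, spanned by
  \<open>r\<close> say. The binary Lie identity forces \<open>[L\<^sub>1, L\<^sub>1] = 0\<close> and \<open>J(A, A, L\<^sub>1) = 0\<close>, and \<open>A\<close> fails to
  be Malcev exactly because \<open>r\<close> acts nontrivially on \<open>L\<^sub>1/L\<^sub>2\<close>. Taking \<open>e\<^sub>4 = r\<close> leaves only the action of
  \<open>e\<^sub>1, e\<^sub>2\<close> on \<open>e\<^sub>3\<close> with values in \<open>L\<^sub>3\<close>, which is zero for \<open>B\<^sub>6\<^sub>,\<^sub>2\<close> and can be normalized to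
  \<open>B\<^sub>6\<^sub>,\<^sub>3\<close> otherwise.
\<close>

subsection \<open>The lower central series and the Jacobian\<close>

context vector_space
begin

lemma span_Un_trans: "U \<subseteq> span W \<Longrightarrow> span (X \<union> U) \<subseteq> span (X \<union> W)"
  by (intro span_minimal subspace_span)
    (use span_mono[of W "X \<union> W"] span_superset[of "X \<union> W"] in blast)

lemma span_Un_span: "span (X \<union> span U) = span (X \<union> U)"
  by (intro equalityI span_Un_trans span_mono) (use span_superset in auto)

end

section \<open>Bilinearity, the Jacobian and the lower central series\<close>

context nonassoc_algebra
begin

lemma br_add_left: "br (x + y) z = br x z + br y z"
  and br_scale_left: "br (scale c x) z = scale c (br x z)"
  and br_add_right: "br z (x + y) = br z x + br z y"
  and br_scale_right: "br z (scale c x) = scale c (br z x)"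
  using linear_left[of z] linear_right[of z]
  by (simp_all add: Vector_Spaces.linear_def module_hom_def module_hom_axioms_def)

lemma br_zero_left [simp]: "br 0 z = 0" and br_zero_right [simp]: "br z 0 = 0"
  using br_scale_left[of 0 0 z] br_scale_right[of z 0 0] by simp_all

lemma br_minus_left: "br (- x) z = - br x z" and br_minus_right: "br z (- x) = - br z x"
  using br_add_left[of "-x" x z] br_add_right[of z "-x" x]
  by (simp_all add: eq_neg_iff_add_eq_0)

lemma br_diff_left: "br (x - y) z = br x z - br y z"
  and br_diff_right: "br z (x - y) = br z x - br z y"
  using br_add_left[of x "-y" z] br_add_right[of z x "-y"]
  by (simp_all add: br_minus_left br_minus_right)

lemmas br_linear = br_add_left br_add_right br_diff_left br_diff_right br_minus_left br_minus_right
  br_scale_left br_scale_right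

text \<open>One span induction per argument. With its trilinear analogue for the Jacobian, it
  reduces inclusions and, for \<open>T = {0}\<close>, vanishing statements to checks on spanning
  sets.\<close>

lemma br_in_subspace:
  assumes "subspace T" "\<And>a b. a \<in> X \<Longrightarrow> b \<in> Y \<Longrightarrow> br a b \<in> T" "x \<in> span X" "y \<in> span Y"
  shows "br x y \<in> T"
proof -
  have "br a y \<in> T" if "a \<in> X" for a
    using assms(4)
  proof (induction rule: span_induct_alt)
    case base then show ?case using assms(1) subspace_0 by simp
  next
    case (step c b z)
    then show ?case using assms(1,2) that
      by (simp add: br_linear subspace_add subspace_scale)
  qed
  with assms(3) show ?thesis
  proof (induction rule: span_induct_alt)
    case base then show ?case using assms(1) subspace_0 by simp
  next
    case (step c b z)
    then show ?case using assms(1)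
      by (simp add: br_linear subspace_add subspace_scale)
  qed
qed

lemma jacobian_add:
  "jacobian (x + x') y z = jacobian x y z + jacobian x' y z"
  "jacobian x (y + y') z = jacobian x y z + jacobian x y' z"
  "jacobian x y (z + z') = jacobian x y z + jacobian x y z'"
  by (simp_all add: jacobian_def br_linear algebra_simps)

lemma jacobian_scale:
  "jacobian (scale c x) y z = scale c (jacobian x y z)"
  "jacobian x (scale c y) z = scale c (jacobian x y z)"
  "jacobian x y (scale c z) = scale c (jacobian x y z)"
  by (simp_all add: jacobian_def br_linear scale_right_distrib)

lemma jacobian_zero [simp]:
  "jacobian 0 y z = 0" "jacobian x 0 z = 0" "jacobian x y 0 = 0"
  by (simp_all add: jacobian_def)

lemma jacobian_minus:
  "jacobian (- x) y z = - jacobian x y z"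
  "jacobian x (- y) z = - jacobian x y z"
  "jacobian x y (- z) = - jacobian x y z"
  by (simp_all add: jacobian_def br_linear)

lemma jacobian_diff_right: "jacobian x y (z - z') = jacobian x y z - jacobian x y z'"
  using jacobian_add(3)[of x y z "- z'"] by (simp add: jacobian_minus)

lemma jacobian_cycle: "jacobian y z x = jacobian x y z"
  by (simp add: jacobian_def algebra_simps)

lemma jacobian_in_subspace:
  assumes T: "subspace T"
    and gen: "\<And>a b c. a \<in> X \<Longrightarrow> b \<in> Y \<Longrightarrow> c \<in> Z \<Longrightarrow> jacobian a b c \<in> T"
    and "x \<in> span X" "y \<in> span Y" "z \<in> span Z"
  shows "jacobian x y z \<in> T"
proof -
  have 1: "jacobian a b z \<in> T" if "a \<in> X" "b \<in> Y" for a b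
    using assms(5)
  proof (induction rule: span_induct_alt)
    case base then show ?case using T subspace_0 by simp
  next
    case (step c b z)
    then show ?case using T gen that
      by (simp add: jacobian_add jacobian_scale subspace_add subspace_scale)
  qed
  have 2: "jacobian a y z \<in> T" if "a \<in> X" for a
    using assms(4)
  proof (induction rule: span_induct_alt)
    case base then show ?case using T subspace_0 by simp
  next
    case (step c b z)
    then show ?case using T 1 that
      by (simp add: jacobian_add jacobian_scale subspace_add subspace_scale)
  qed
  from assms(3) show ?thesis
  proof (induction rule: span_induct_alt)
    case base then show ?case using T subspace_0 by simp
  next
    case (step c b z)
    then show ?case using T 2
      by (simp add: jacobian_add jacobian_scale subspace_add subspace_scale)
  qed
qed

text \<open>Indexing starts at 0, so index 1 is the derived algebra. Unlike in
  \<open>alg_power\<close>, only products with the whole algebra enter; the terms lie inside the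
  powers, so nilpotency still forces them to reach zero.\<close>

primrec lower_central :: "nat \<Rightarrow> 'b set" where
  "lower_central 0 = UNIV"
| "lower_central (Suc n) = span {br x y | x y. x \<in> lower_central n}"

lemma subspace_lower_central: "subspace (lower_central n)"
  by (cases n) (auto simp: subspace_UNIV)

declare lower_central.simps(2) [simp del]

text \<open>Spelled with \<open>Suc\<close> so that facts about \<open>lower_central (Suc n)\<close>
  apply to them by unification.\<close>

abbreviation "L1 \<equiv> lower_central (Suc 0)"
abbreviation "L2 \<equiv> lower_central (Suc (Suc 0))"
abbreviation "L3 \<equiv> lower_central (Suc (Suc (Suc 0)))"
abbreviation "L4 \<equiv> lower_central (Suc (Suc (Suc (Suc 0))))"
abbreviation "L5 \<equiv> lower_central (Suc (Suc (Suc (Suc (Suc 0)))))"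

lemma span_lower_central [simp]: "span (lower_central n) = lower_central n"
  by (simp add: span_eq_iff subspace_lower_central)

lemma br_left_lower_central: "x \<in> lower_central n \<Longrightarrow> br x y \<in> lower_central (Suc n)"
  by (auto simp: lower_central.simps(2) intro: span_base)

lemma br_in_lower_central_1: "br x y \<in> lower_central (Suc 0)"
  by (rule br_left_lower_central) simp

lemma lower_central_Suc_subset: "lower_central (Suc n) \<subseteq> lower_central n"
proof (induction n)
  case (Suc n)
  have "{br x y | x y. x \<in> lower_central (Suc n)} \<subseteq> {br x y | x y. x \<in> lower_central n}"
    using Suc by blast
  from span_mono[OF this] show ?case by (simp only: lower_central.simps)
qed simp

lemma lower_central_Suc_minimal:
  assumes "subspace T" "\<And>a b. a \<in> X \<Longrightarrow> b \<in> Y \<Longrightarrow> br a b \<in> T"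
    and "lower_central n \<subseteq> span X" "span Y = UNIV"
  shows "lower_central (Suc n) \<subseteq> T"
proof -
  have "{br x y | x y. x \<in> lower_central n} \<subseteq> T"
    using br_in_subspace[OF assms(1,2)] assms(3,4) by blast
  then show ?thesis using assms(1) span_minimal by (simp add: lower_central.simps(2))
qed

text \<open>The summand \<open>i = 1\<close> of the power already contains every product of the
  preceding term with the whole algebra. The index shift arises because \<open>alg_power\<close>
  counts from 1.\<close>

lemma lower_central_subset_alg_power: "lower_central n \<subseteq> alg_power (Suc n)"
proof (induction n)
  case 0
  then show ?case by (simp add: alg_power.simps)
next
  case (Suc n)
  have "{br x y | x y. x \<in> lower_central n}
      \<subseteq> (\<Union>i\<in>{1..<Suc (Suc n)}.
            {br x y | x y. x \<in> alg_power (Suc (Suc n) - i) \<and> y \<in> alg_power i})" (is "_ \<subseteq> ?U")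
  proof clarify
    fix x y assume "x \<in> lower_central n"
    then have "x \<in> alg_power (Suc (Suc n) - 1)" "y \<in> alg_power 1"
      using Suc by (auto simp: alg_power.simps[of "Suc 0"])
    then show "br x y \<in> ?U"
      by (intro UN_I[of 1]) auto
  qed
  then show ?case
    by (subst alg_power.simps) (simp add: span_mono lower_central.simps(2))
qed

lemma lower_central_stable:
  assumes "lower_central (Suc n) = lower_central n" "n \<le> m"
  shows "lower_central m = lower_central n"
  using assms(2)
proof (induction m rule: dec_induct)
  case (step m)
  then have "lower_central (Suc m) = lower_central (Suc n)" by (simp only: lower_central.simps)
  with assms(1) show ?case by (rule trans[rotated])
qed (rule refl)

text \<open>Each term determines the next, so one repetition makes the series constant from there
  on; nilpotency makes some term zero.\<close>

lemma nilpotent_lower_central: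
  assumes nilpotent and "lower_central (Suc n) = lower_central n"
  shows "lower_central n = {0}"
proof -
  obtain k where k: "k \<ge> 1" "alg_power k = {0}"
    using assms(1) by (auto simp: nilpotent_def)
  then have "lower_central (k - 1) \<subseteq> {0}"
    using lower_central_subset_alg_power[of "k - 1"] by simp
  moreover have zero: "0 \<in> lower_central m" for m
    by (rule subspace_0) (rule subspace_lower_central)
  ultimately have k0: "lower_central (k - 1) = {0}" by blast
  show ?thesis
  proof (cases "n \<le> k - 1")
    case True
    then show ?thesis using lower_central_stable[OF assms(2) True] k0 by (simp only:)
  next
    case False
    then have "lower_central n \<subseteq> lower_central (k - 1)"
      using lift_Suc_antimono_le[of lower_central "k - 1" n, OF lower_central_Suc_subset] by linarith
    then show ?thesis using k0 zero[of n] by blast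
  qed
qed

end

section \<open>Consequences of anticommutativity\<close>

context anticommutative_algebra
begin

declare br_self [simp]

lemma br_anticommute: "br y x = - br x y"
  using br_self[of "x + y"] by (simp add: br_linear add_eq_0_iff del: br_self)
    (simp add: eq_neg_iff_add_eq_0 add.commute)

lemma br_right_lower_central: "x \<in> lower_central n \<Longrightarrow> br y x \<in> lower_central (Suc n)"
  using br_left_lower_central[of x n y] subspace_lower_central subspace_neg
  by (metis br_anticommute)

lemma jacobian_swap: "jacobian y x z = - jacobian x y z" "jacobian x z y = - jacobian x y z"
  using br_anticommute[of x y] br_anticommute[of x z] br_anticommute[of y z]
  by (simp_all add: jacobian_def br_linear)

lemma jacobian_same [simp]: "jacobian x x z = 0" "jacobian x z z = 0" "jacobian x z x = 0"
  using br_anticommute[of x z]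
  by (simp_all add: jacobian_def br_linear)

text \<open>The Jacobian is alternating. Case checks over triples of generators treat one ordering
  of each triple and take the others from here.\<close>

lemma jacobian_perm_0:
  assumes "jacobian x y z = 0"
  shows "jacobian x z y = 0" "jacobian y x z = 0" "jacobian y z x = 0" "jacobian z x y = 0"
    "jacobian z y x = 0"
proof -
  show 1: "jacobian x z y = 0" and 2: "jacobian y x z = 0" and "jacobian y z x = 0"
    using assms by (simp_all only: jacobian_swap(2)[of x z y] jacobian_swap(1)[of y x z]
      jacobian_cycle[of y z x] neg_equal_0_iff_equal)
  show "jacobian z x y = 0" "jacobian z y x = 0"
    using assms 1 jacobian_cycle by metis+
qed

end

section \<open>Linearizations of the binary Lie identity\<close>

context binary_lie_algebra
begin

lemma jacobian_br_same: "jacobian x y (br x y) = 0"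
  using binary_lie[of x y] by (simp add: jacobian_cycle)

text \<open>Polarization of J(x, y, [x, y]) = 0 in \<open>y\<close>: the mixed terms at
  \<open>y + z\<close> must cancel.\<close>

lemma jacobian_br_swap: "jacobian x y (br x z) = - jacobian x z (br x y)"
  using jacobian_br_same[of x "y + z"] jacobian_br_same[of x y] jacobian_br_same[of x z]
  by (simp add: jacobian_add br_linear eq_neg_iff_add_eq_0 add.commute)

text \<open>A second polarization, now in \<open>x\<close>: \<open>?S\<close> is quadratic in
  \<open>x\<close> and vanishes identically, hence so does its polar form.\<close>

lemma jacobian_br_linearized:
  "jacobian x y (br w z) + jacobian w y (br x z) = - (jacobian x z (br w y) + jacobian w z (br x y))"
proof -
  let ?S = "\<lambda>x. jacobian x y (br x z) + jacobian x z (br x y)"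
  have "?S (x + w) = ?S x + ?S w + (jacobian x y (br w z) + jacobian w y (br x z)
      + (jacobian x z (br w y) + jacobian w z (br x y)))"
    by (simp add: jacobian_add br_linear ac_simps)
  moreover have "?S v = 0" for v by (simp add: jacobian_br_swap[of v y z])
  ultimately have "jacobian x y (br w z) + jacobian w y (br x z)
      + (jacobian x z (br w y) + jacobian w z (br x y)) = 0"
    by simp
  then show ?thesis by (simp only: eq_neg_iff_add_eq_0)
qed

end

subsection \<open>Two-generated binary Lie algebras\<close>

context anticommutative_algebra
begin

lemma lower_central_central:
  assumes "lower_central (Suc n) = {0}" "x \<in> lower_central n"
  shows "br x y = 0" "br y x = 0"
  using br_left_lower_central[OF assms(2)] br_right_lower_central[OF assms(2)] assms(1) by blast+

lemma jacobian_central: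
  assumes "lower_central (Suc n) = {0}" "x \<in> lower_central n"
  shows "jacobian x y z = 0" "jacobian y x z = 0" "jacobian y z x = 0"
proof -
  have "br x y = 0" "br y x = 0" for y using lower_central_central[OF assms] by blast+
  then show "jacobian x y z = 0" "jacobian y x z = 0" "jacobian y z x = 0"
    by (simp_all add: jacobian_def)
qed

lemma jacobian_in_L2: "jacobian x y z \<in> L2"
  unfolding jacobian_def
  by (intro subspace_add subspace_lower_central br_left_lower_central) simp_all

lemma malcev_if_jacobian_0:
  assumes "\<And>x y z. jacobian x y z = 0"
  shows "malcev_algebra scale br"
  by unfold_locales (simp add: assms)

text \<open>As \<open>L2\<close> is central, only [[x, y], [x, z]] survives in J(x, y, [x, z]), and
  it is a product in \<open>L1\<close>. The other side vanishes because Jacobians lie in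
  \<open>L2\<close>.\<close>

lemma malcev_if_L1_abelian:
  assumes "L3 = {0}" and "\<And>x y. x \<in> L1 \<Longrightarrow> y \<in> L1 \<Longrightarrow> br x y = 0"
  shows "malcev_algebra scale br"
proof unfold_locales
  fix x y z
  have L1: "br u v \<in> L1" for u v by (simp add: br_left_lower_central)
  then have "br u (br v w) \<in> L2" "br (br v w) u \<in> L2" for u v w
    by (simp_all add: br_left_lower_central br_right_lower_central)
  then have "jacobian x y (br x z) = br (br x y) (br x z)"
    by (simp add: jacobian_def lower_central_central[OF assms(1)])
  also have "\<dots> = 0" using L1 assms(2) by simp
  also have "\<dots> = br (jacobian x y z) x"
    by (simp add: lower_central_central[OF assms(1) jacobian_in_L2])
  finally show "jacobian x y (br x z) = br (jacobian x y z) x" .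
qed

text \<open>Modulo the central \<open>L2\<close> both factors are multiples of \<open>u\<close>, and
  [u, u] = 0.\<close>

lemma L1_abelian_if_cyclic:
  assumes "L3 = {0}" "L1 \<subseteq> span (insert u L2)" "x \<in> L1" "y \<in> L1"
  shows "br x y = 0"
proof -
  have "br x y \<in> {0}"
  proof (rule br_in_subspace[of _ "insert u L2" "insert u L2"])
    show "br a b \<in> {0}" if "a \<in> insert u L2" "b \<in> insert u L2" for a b
      using that lower_central_central[OF assms(1)] by auto
  qed (use assms in \<open>auto simp: subspace_single_0\<close>)
  then show ?thesis by simp
qed

lemma jacobian_0_if_generators:
  assumes "span X = UNIV" "\<And>x y z. x \<in> X \<Longrightarrow> y \<in> X \<Longrightarrow> z \<in> X \<Longrightarrow> jacobian x y z = 0"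
  shows "jacobian x y z = 0"
proof -
  have "jacobian x y z \<in> {0}"
    by (rule jacobian_in_subspace[of _ X X X]) (use assms in \<open>auto simp: subspace_single_0\<close>)
  then show ?thesis by simp
qed

text \<open>A product with a factor in \<open>L1\<close> lies in \<open>L2\<close>, so up to sign
  [a, b] is the only product of generators that counts.\<close>

lemma two_generators_L1:
  assumes "span ({a, b} \<union> L1) = UNIV"
  shows "L1 \<subseteq> span ({br a b} \<union> L2)"
proof (rule lower_central_Suc_minimal[of _ "{a, b} \<union> L1" "{a, b} \<union> L1"])
  let ?T = "span ({br a b} \<union> L2)"
  have ab: "br a b \<in> ?T" by (simp add: span_base)
  then have ba: "br b a \<in> ?T" using br_anticommute[of b a] span_neg by metis
  have "L2 \<subseteq> ?T" by (auto intro: span_base)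
  then have "br x y \<in> ?T" "br y x \<in> ?T" if "x \<in> L1" for x y
    using that br_left_lower_central br_right_lower_central by blast+
  then show "br x y \<in> ?T" if "x \<in> {a, b} \<union> L1" "y \<in> {a, b} \<union> L1" for x y
    using that ab ba span_zero by auto
qed (use assms in auto)

lemma two_generators_L2:
  assumes "span ({a, b} \<union> L1) = UNIV"
  defines "c \<equiv> br a b"
  shows "L2 \<subseteq> span ({br c a, br c b} \<union> L3)"
proof (rule lower_central_Suc_minimal[of _ "{c} \<union> L2" "{a, b} \<union> ({c} \<union> L2)"])
  show "L1 \<subseteq> span ({c} \<union> L2)" unfolding c_def by (rule two_generators_L1[OF assms(1)])
  then show "span ({a, b} \<union> ({c} \<union> L2)) = UNIV" using span_Un_trans[of L1 "{c} \<union> L2" "{a,b}"] assms(1)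
    by blast
  let ?T = "span ({br c a, br c b} \<union> L3)"
  have L3: "L3 \<subseteq> ?T" by (auto intro: span_base)
  then have "br x y \<in> ?T" "br y x \<in> ?T" if "x \<in> L2" for x y
    using that br_left_lower_central br_right_lower_central by blast+
  moreover have "br c a \<in> ?T" "br c b \<in> ?T" by (auto intro: span_base)
  ultimately show "br x y \<in> ?T" if "x \<in> {c} \<union> L2" "y \<in> {a, b} \<union> ({c} \<union> L2)" for x y
    using that span_zero by auto
qed simp

end

section \<open>Vanishing of the Jacobian for two generators\<close>

context binary_lie_algebra
begin

text \<open>The algebra is spanned by \<open>a\<close>, \<open>b\<close>, \<open>c\<close> = [a, b],
  \<open>p\<close> = [a, c], \<open>q\<close> = [b, c] and the central \<open>L3\<close>. Each of
  the ten triples of these five vectors is killed by the binary Lie identity, by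
  \<open>jacobian_br_swap\<close>, or because a product with \<open>p\<close> or \<open>q\<close> is
  central.\<close>

lemma two_generators_jacobian_class4:
  assumes gen: "span ({a, b} \<union> L1) = UNIV" and L4: "L4 = {0}"
  shows "jacobian x y z = 0"
proof (rule jacobian_0_if_generators)
  define c where "c = br a b"
  define p where "p = br a c"
  define q where "q = br b c"
  have "L1 \<subseteq> span ({c} \<union> L2)" using two_generators_L1[OF gen] by (simp only: c_def)
  moreover have "L2 \<subseteq> span ({p, q} \<union> L3)"
  proof -
    have "{br c a, br c b} \<union> L3 \<subseteq> span ({p, q} \<union> L3)"
      unfolding p_def q_def br_anticommute[of c a] br_anticommute[of c b]
      by (auto intro: span_base span_neg)
    then show ?thesis using two_generators_L2[OF gen] span_minimal subspace_span
      unfolding c_def by blast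
  qed
  ultimately have "L1 \<subseteq> span ({c} \<union> ({p, q} \<union> L3))"
    using span_Un_trans by blast
  then show "span ({a, b} \<union> ({c} \<union> ({p, q} \<union> L3))) = UNIV"
    using span_Un_trans gen by blast
  have cab: "jacobian a b c = 0" using jacobian_br_same[of a b] by (simp only: c_def)
  have acp: "jacobian a c p = 0" unfolding p_def by (rule jacobian_br_same)
  have bcq: "jacobian b c q = 0" unfolding q_def by (rule jacobian_br_same)
  have "jacobian a b p = - jacobian a c c" unfolding p_def by (subst jacobian_br_swap) (simp only: c_def)
  then have abp: "jacobian a b p = 0" by simp
  have ba: "br b a = - c" using br_anticommute[of b a] by (simp add: c_def)
  have "jacobian b a q = - jacobian b c (- c)" unfolding q_def by (subst jacobian_br_swap) (simp only: ba)
  then have baq: "jacobian b a q = 0" by (simp add: jacobian_minus)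
  have pL2: "p \<in> L2" and qL2: "q \<in> L2" unfolding p_def q_def c_def
    by (simp_all add: br_left_lower_central br_right_lower_central)
  have L3: "br x y \<in> L3" "br y x \<in> L3" if "x = p \<or> x = q" for x y
    using that pL2 qL2 by (auto simp: br_left_lower_central br_right_lower_central)
  have L30: "br (br x y) z = 0" "br (br y x) z = 0" if "x = p \<or> x = q" for x y z
    using L3[OF that] lower_central_central[OF L4] by blast+
  have "jacobian a q c = - jacobian a b (br a q)"
    using jacobian_br_swap[of a q b] by (simp only: c_def)
  then have aqc: "jacobian a q c = 0" using jacobian_central(3)[OF L4 L3(2)] by simp
  have "jacobian b p (- c) = - jacobian b a (br b p)"
    using jacobian_br_swap[of b p a] by (simp only: ba)
  then have bpc: "jacobian b p c = 0" using jacobian_central(3)[OF L4 L3(2)]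
    by (simp add: jacobian_minus)
  have pq: "jacobian p q x = 0" for x by (simp add: jacobian_def L30)
  note z = cab acp bcq abp baq aqc bpc pq
  show "jacobian x y z = 0"
    if "x \<in> {a, b} \<union> ({c} \<union> ({p, q} \<union> L3))" "y \<in> {a, b} \<union> ({c} \<union> ({p, q} \<union> L3))"
      "z \<in> {a, b} \<union> ({c} \<union> ({p, q} \<union> L3))" for x y z
    using that
    by (elim UnE insertE emptyE)
      (simp_all add: jacobian_central[OF L4] z z[THEN jacobian_perm_0(1)]
        z[THEN jacobian_perm_0(2)] z[THEN jacobian_perm_0(3)] z[THEN jacobian_perm_0(4)] z[THEN jacobian_perm_0(5)])
qed

text \<open>Since [b, [a, b]] lies in \<open>L3\<close>, the vectors \<open>a\<close>,
  \<open>b\<close>, \<open>c\<close>, \<open>p\<close>, \<open>r\<close> and the central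
  \<open>L4\<close> span the algebra, and again ten triples have to be checked. For \<open>v\<close>
  in \<open>L3\<close> the Jacobian J(x, y, v) reduces to [[x, y], v], which is zero once [x, y]
  lies in \<open>L3\<close>.\<close>

lemma two_generators_jacobian_class5:
  assumes gen: "span ({a, b} \<union> L1) = UNIV" and L5: "L5 = {0}"
    and q: "br b (br a b) \<in> L3" and r: "L3 \<subseteq> span ({r} \<union> L4)" "r \<in> L3"
  shows "jacobian x y z = 0"
proof (rule jacobian_0_if_generators)
  define c where "c = br a b"
  define p where "p = br a c"
  have "L1 \<subseteq> span ({c} \<union> L2)" using two_generators_L1[OF gen] by (simp only: c_def)
  moreover have L2: "L2 \<subseteq> span ({p} \<union> L3)"
  proof -
    have "{br c a, br c b} \<union> L3 \<subseteq> span ({p} \<union> L3)"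
    proof -
      have "br c a = - p" "br c b = - br b c"
        unfolding p_def by (rule br_anticommute)+
      moreover have "br b c \<in> L3" using q by (simp add: c_def)
      ultimately show ?thesis by (auto intro!: span_base span_neg)
    qed
    then show ?thesis using two_generators_L2[OF gen] span_minimal subspace_span
      unfolding c_def by blast
  qed
  ultimately have "L1 \<subseteq> span ({c} \<union> ({p} \<union> L3))"
    using span_Un_trans by blast
  then have gen1: "span ({a, b} \<union> ({c} \<union> ({p} \<union> L3))) = UNIV"
    using span_Un_trans gen by blast
  moreover have "span ({a, b, c, p} \<union> L3) \<subseteq> span ({a, b, c, p} \<union> ({r} \<union> L4))"
    by (rule span_Un_trans[OF r(1)])
  ultimately show gen2: "span ({a, b, c, p} \<union> ({r} \<union> L4)) = UNIV"
    by (simp add: top.extremum_unique insert_commute)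
  have cab: "jacobian a b c = 0" using jacobian_br_same[of a b] by (simp only: c_def)
  have acp: "jacobian a c p = 0" unfolding p_def by (rule jacobian_br_same)
  have "jacobian a b p = - jacobian a c c" unfolding p_def by (subst jacobian_br_swap) (simp only: c_def)
  then have abp: "jacobian a b p = 0" by simp
  have ba: "br b a = - c" using br_anticommute[of b a] by (simp add: c_def)
  have pL2: "p \<in> L2" unfolding p_def c_def
    by (simp_all add: br_left_lower_central br_right_lower_central)
  have L3c: "br (br y x) z = 0" "br (br x y) z = 0" if "x \<in> L3" for x y z
    using that lower_central_central[OF L5] br_left_lower_central br_right_lower_central by metis+
  have J: "jacobian x y v = br (br x y) v" if "v \<in> L3" for x y v
    using that by (simp add: jacobian_def L3c)
  have L33: "br x y = 0" if "x \<in> L3" "y \<in> L3" for x y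
  proof -
    have "br x y \<in> {0}"
      by (rule br_in_subspace[of _ "{r} \<union> L4" "{r} \<union> L4"])
        (use that r lower_central_central[OF L5] in \<open>auto simp: subspace_single_0\<close>)
    then show ?thesis by simp
  qed
  \<comment> \<open>Here [a, c] = \<open>p\<close> need not lie in \<open>L3\<close>, so the
    reduction above does not decide this triple. Writing \<open>c\<close> as [a, b] allows a swap to
    the central [a, r].\<close>
  have "jacobian a r c = - jacobian a b (br a r)"
    using jacobian_br_swap[of a r b] by (simp only: c_def)
  then have arc: "jacobian a r c = 0"
    using jacobian_central(3)[OF L5 br_right_lower_central[OF r(2)]] by simp
  have pL3: "br p y \<in> L3" "br y p \<in> L3" for y
    using pL2 by (auto simp: br_left_lower_central br_right_lower_central)
  have bcL3: "br b c \<in> L3" using q by (simp add: c_def)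
  have acL3: "jacobian a c v = 0" if "v \<in> L3" for v
  proof -
    have acr: "jacobian a c r = 0" using arc by (rule jacobian_perm_0)
    have "jacobian a c v \<in> {0}"
    proof (rule jacobian_in_subspace[of "{0}" "{a}" "{c}" "{r} \<union> L4"])
      show "v \<in> span ({r} \<union> L4)" using that r(1) by blast
      show "jacobian x y z \<in> {0}" if "x \<in> {a}" "y \<in> {c}" "z \<in> {r} \<union> L4" for x y z
        using that acr jacobian_central(3)[OF L5] by blast
    qed (simp_all add: subspace_single_0 span_base)
    then show ?thesis by simp
  qed
  have "jacobian b c v = 0" "jacobian a p v = 0" "jacobian b p v = 0" "jacobian c p v = 0"
    if v: "v \<in> L3" for v
    unfolding J[OF v] by (rule L33[OF _ v], rule bcL3 pL3)+
  note cL3 = acL3 this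
  \<comment> \<open>Reading \<open>p\<close> as -[c, a] puts the swap at base point \<open>c\<close>
    and exchanges [c, a] for [c, b], which lies in \<open>L3\<close>.\<close>
  have "jacobian b c p = - jacobian c b (br a c)" unfolding p_def by (simp add: jacobian_swap(1)[of b c])
  also have "\<dots> = jacobian c b (br c a)" using br_anticommute[of c a] by (simp add: jacobian_def br_linear)
  also have "\<dots> = - jacobian c a (br c b)" by (rule jacobian_br_swap)
  also have "\<dots> = jacobian a c (br c b)" using jacobian_swap(1)[of c a] by simp
  also have "\<dots> = 0"
    using cL3(1) bcL3 br_anticommute[of c b] subspace_neg[OF subspace_lower_central] by simp
  finally have bcp: "jacobian b c p = 0" .
  \<comment> \<open>The kernel of J(a, b, -) is a subspace containing the central \<open>L4\<close>,
    so only the products of \<open>p\<close> with \<open>a\<close>, \<open>b\<close> and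
    \<open>c\<close> have to be tested.\<close>
  have "L3 \<subseteq> {v. jacobian a b v = 0}"
  proof (rule lower_central_Suc_minimal[OF _ _ L2 gen1])
    show "subspace {v. jacobian a b v = 0}"
      by (rule subspaceI) (simp_all add: jacobian_add jacobian_scale)
    fix x y assume x: "x \<in> {p} \<union> L3" and y: "y \<in> {a, b} \<union> ({c} \<union> ({p} \<union> L3))"
    have pa: "jacobian a b (br p a) = 0"
      using jacobian_br_swap[of a b p] acp br_anticommute[of p a] jacobian_perm_0(1)[OF acp]
      by (simp add: jacobian_minus c_def)
    have "jacobian b a (br b p) = jacobian b p c"
      using jacobian_br_swap[of b a p] by (simp add: ba jacobian_minus)
    then have "jacobian b a (br b p) = 0" by (simp only: jacobian_perm_0(1)[OF bcp])
    then have "jacobian a b (br b p) = 0" by (rule jacobian_perm_0)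
    then have pb: "jacobian a b (br p b) = 0"
      using br_anticommute[of p b] by (simp add: jacobian_minus)
    have "jacobian a b (br c p) + jacobian c b (br a p) = - (jacobian a p (br c b) + jacobian c p (br a b))"
      by (rule jacobian_br_linearized)
    moreover have "br c b \<in> L3"
      using bcL3 br_anticommute[of c b] subspace_neg[OF subspace_lower_central] by simp
    moreover have "jacobian c b (br a p) = 0" by (rule jacobian_perm_0(2)[OF cL3(2)[OF pL3(2)]])
    moreover have "jacobian c p c = 0" by simp
    ultimately have "jacobian a b (br c p) = 0" using cL3 by (simp add: c_def)
    then have pc: "jacobian a b (br p c) = 0"
      using br_anticommute[of p c] by (simp add: jacobian_minus)
    have L4: "jacobian a b v = 0" if "v \<in> L4" for v using jacobian_central[OF L5 that] by simp
    have "jacobian a b (br p v) = 0" "jacobian a b (br v u) = 0" if "v \<in> L3" for u v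
      by (rule L4, rule br_right_lower_central[OF that], rule L4, rule br_left_lower_central[OF that])
    then have "jacobian a b (br x y) = 0" using x y pa pb pc by auto
    then show "br x y \<in> {v. jacobian a b v = 0}" by simp
  qed
  then have abr: "jacobian a b r = 0" using r(2) by blast
  note z = cab acp abp abr bcp cL3[OF r(2)]
  show "jacobian x y z = 0"
    if "x \<in> {a, b, c, p} \<union> ({r} \<union> L4)" "y \<in> {a, b, c, p} \<union> ({r} \<union> L4)"
      "z \<in> {a, b, c, p} \<union> ({r} \<union> L4)" for x y z
    using that
    by (elim UnE insertE emptyE)
      (simp_all add: jacobian_central[OF L5] z z[THEN jacobian_perm_0(1)]
        z[THEN jacobian_perm_0(2)] z[THEN jacobian_perm_0(3)] z[THEN jacobian_perm_0(4)] z[THEN jacobian_perm_0(5)])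
qed

end

subsection \<open>Dimensions of the lower central series\<close>

context finite_dimensional_vector_space
begin

lemma subspace_extend:
  assumes "subspace U" "subspace V" "U \<subseteq> V" "dim V = Suc n" "dim U \<le> n"
  obtains v where "v \<in> V" "span ({v} \<union> U) \<subseteq> V" "dim (span ({v} \<union> U)) = Suc (dim U)"
proof -
  have "U \<noteq> V" using assms by auto
  then obtain v where v: "v \<in> V" "v \<notin> U" using assms(3) by blast
  have "span ({v} \<union> U) \<subseteq> V" using v assms by (intro span_minimal) auto
  moreover have "dim (span ({v} \<union> U)) = Suc (dim U)"
    using v(2) assms(1) by (simp add: dim_insert span_eq_iff[THEN iffD2])
  ultimately show thesis using that v by blast
qed

lemma subspace_complement_1:
  assumes "subspace U" "subspace V" "U \<subseteq> V" "dim V = Suc (dim U)"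
  obtains v where "v \<in> V" "span ({v} \<union> U) = V"
proof -
  obtain v where "v \<in> V" "span ({v} \<union> U) \<subseteq> V" "dim (span ({v} \<union> U)) = Suc (dim U)"
    by (rule subspace_extend[OF assms]) simp
  then show thesis using that subspace_dim_equal[of "span ({v} \<union> U)" V] assms by simp
qed

lemma subspace_complement_2:
  assumes "subspace U" "subspace V" "U \<subseteq> V" "dim V = Suc (Suc (dim U))"
  obtains v w where "v \<in> V" "w \<in> V" "span ({v, w} \<union> U) = V"
proof -
  obtain w where w: "w \<in> V" "span ({w} \<union> U) \<subseteq> V" "dim (span ({w} \<union> U)) = Suc (dim U)"
    by (rule subspace_extend[OF assms]) simp
  obtain v where "v \<in> V" "span ({v} \<union> span ({w} \<union> U)) = V"
    by (rule subspace_complement_1[of "span ({w} \<union> U)" V]) (use w assms in simp_all)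
  moreover have "span ({v} \<union> span ({w} \<union> U)) = span ({v, w} \<union> U)"
    by (simp only: span_Un_span) (simp add: insert_commute)
  ultimately show thesis using that w by simp
qed

lemma subspace_complement_3:
  assumes "subspace U" "subspace V" "U \<subseteq> V" "dim V = Suc (Suc (Suc (dim U)))"
  obtains u v w where "span ({u, v, w} \<union> U) = V"
proof -
  obtain w where w: "w \<in> V" "span ({w} \<union> U) \<subseteq> V" "dim (span ({w} \<union> U)) = Suc (dim U)"
    by (rule subspace_extend[OF assms]) simp
  obtain u v where "span ({u, v} \<union> span ({w} \<union> U)) = V"
    by (rule subspace_complement_2[of "span ({w} \<union> U)" V]) (use w assms in simp_all)
  moreover have "span ({u, v} \<union> span ({w} \<union> U)) = span ({u, v, w} \<union> U)"
    by (simp only: span_Un_span) (simp add: insert_commute)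
  ultimately show thesis using that by simp
qed

lemma dim_span_insert_le:
  assumes "V \<subseteq> span ({v} \<union> U)"
  shows "dim V \<le> Suc (dim U)"
proof -
  have "dim V \<le> dim (span ({v} \<union> U))" using assms dim_subset by blast
  also have "\<dots> \<le> Suc (dim U)" by (simp add: dim_insert)
  finally show ?thesis .
qed

lemma dim_0_iff: "subspace U \<Longrightarrow> dim U = 0 \<longleftrightarrow> U = {0}"
  using subspace_0[of U] by auto

end

section \<open>Possible dimension sequences in dimension six\<close>

locale nilpotent_binary_lie_6 =
  binary_lie_algebra scale br + finite_dimensional_vector_space scale Basis
  for scale :: "'a::field \<Rightarrow> 'b::ab_group_add \<Rightarrow> 'b" and br Basis +
  assumes dim_UNIV_6: "dim UNIV = 6" and nilpotent: "nilpotent"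
begin

lemma dim_lower_central_Suc:
  "lower_central n = {0} \<or> dim (lower_central (Suc n)) < dim (lower_central n)"
proof (cases "lower_central (Suc n) = lower_central n")
  case True
  then show ?thesis using nilpotent_lower_central[OF nilpotent] by blast
next
  case False
  moreover have "dim (lower_central (Suc n)) \<le> dim (lower_central n)"
    using dim_subset lower_central_Suc_subset by blast
  ultimately show ?thesis
    using subspace_dim_equal[OF subspace_lower_central subspace_lower_central lower_central_Suc_subset, of n]
    by linarith
qed

lemma dim_lower_central_eq_0: "dim (lower_central n) = 0 \<longleftrightarrow> lower_central n = {0}"
  by (rule dim_0_iff) (rule subspace_lower_central)

lemma dim_lower_central_decreasing:
  "dim (lower_central (Suc n)) \<le> dim (lower_central n) - 1"
proof (cases "lower_central n = {0}")
  case True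
  then have "lower_central (Suc n) = {0}"
    using lower_central_Suc_subset[of n] subspace_0[OF subspace_lower_central, of "Suc n"] by auto
  then show ?thesis by simp
next
  case False
  then show ?thesis using dim_lower_central_Suc[of n] by simp
qed

text \<open>In codimension one a single \<open>v\<close> generates modulo \<open>L1\<close>, and
  [v, v] = 0 gives \<open>L1 = L2\<close>. A series that stabilizes is zero, a
  contradiction.\<close>

lemma dim_L1_le: "dim L1 \<le> 4"
proof (rule ccontr)
  assume "\<not> dim L1 \<le> 4"
  moreover have "dim (lower_central 0) = 6" using dim_UNIV_6 by simp
  ultimately have "dim (lower_central 0) = Suc (dim L1)"
    using dim_lower_central_decreasing[of 0] by linarith
  then obtain v where v: "span ({v} \<union> L1) = lower_central 0"
    by (rule subspace_complement_1[OF subspace_lower_central subspace_lower_central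
          lower_central_Suc_subset])
  have "L1 \<subseteq> L2"
  proof (rule lower_central_Suc_minimal[of _ "{v} \<union> L1" "{v} \<union> L1"])
    show "br a b \<in> L2" if "a \<in> {v} \<union> L1" "b \<in> {v} \<union> L1" for a b
      using that subspace_0[OF subspace_lower_central]
      by (auto simp: br_left_lower_central br_right_lower_central)
  qed (use v in \<open>auto simp: subspace_lower_central\<close>)
  then have "L1 = {0}"
    using nilpotent_lower_central[OF nilpotent, of "Suc 0"] lower_central_Suc_subset by blast
  then show False using \<open>\<not> dim L1 \<le> 4\<close> by simp
qed

text \<open>Two generators leave \<open>L1/L2\<close> of dimension one, so the series either has
  \<open>L4 = {0}\<close> or dimensions 6, 4, 3, 2, 1, 0. In the latter case \<open>L2/L3\<close> is
  one-dimensional, so the generators can be chosen with [b, [a, b]] in \<open>L3\<close>.\<close>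

lemma malcev_if_dim_L1_4:
  assumes L1: "dim L1 = 4"
  shows "malcev_algebra scale br"
proof (rule malcev_if_jacobian_0)
  fix x y z
  have sub: "subspace (lower_central n)" "lower_central (Suc n) \<subseteq> lower_central n" for n
    by (rule subspace_lower_central, rule lower_central_Suc_subset)
  obtain a b where "span ({a, b} \<union> L1) = lower_central 0"
    by (rule subspace_complement_2[OF sub(1) sub(1) sub(2), of 0]) (use dim_UNIV_6 L1 in simp_all)
  then have ab: "span ({a, b} \<union> L1) = UNIV" by simp
  have "dim L1 \<le> Suc (dim L2)"
    by (rule dim_span_insert_le) (rule two_generators_L1[OF ab])
  then have L2: "dim L2 = 3" using dim_lower_central_decreasing[of "Suc 0"] L1 by linarith
  have dims: "dim L3 \<le> 2" "dim L4 \<le> dim L3 - 1" "dim L5 \<le> dim L4 - 1"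
    using dim_lower_central_decreasing[of "Suc (Suc 0)"] L2
      dim_lower_central_decreasing[of "Suc (Suc (Suc 0))"]
      dim_lower_central_decreasing[of "Suc (Suc (Suc (Suc 0)))"] by simp_all
  show "jacobian x y z = 0"
  proof (cases "dim L4 = 0")
    case True
    then have "L4 = {0}" by (simp only: dim_lower_central_eq_0)
    then show ?thesis by (rule two_generators_jacobian_class4[OF ab])
  next
    case False
    then have L4: "dim L4 = 1" and L3: "dim L3 = 2" and "dim L5 = 0" using dims by linarith+
    then have L5: "L5 = {0}" by (simp only: dim_lower_central_eq_0)
    obtain r where r: "r \<in> L3" "span ({r} \<union> L4) = L3"
      by (rule subspace_complement_1[OF sub(1) sub(1) sub(2), of "Suc (Suc (Suc 0))"])
        (use L3 L4 in simp_all)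
    obtain p where p: "span ({p} \<union> L3) = L2"
      by (rule subspace_complement_1[OF sub(1) sub(1) sub(2), of "Suc (Suc 0)"])
        (use L2 L3 in simp_all)
    have jac: "jacobian x y z = 0"
      if "span ({a, b} \<union> L1) = UNIV" "br b (br a b) \<in> L3" for a b
      by (rule two_generators_jacobian_class5[OF that(1) L5 that(2)]) (use r in auto)
    define c where "c = br a b"
    have "br b c \<in> span ({p} \<union> L3)" "br a c \<in> span ({p} \<union> L3)"
      unfolding p c_def by (simp_all add: br_left_lower_central br_right_lower_central)
    then obtain s t where s: "br a c - scale s p \<in> L3" and t: "br b c - scale t p \<in> L3"
      by (auto simp: span_insert)
    show ?thesis
    proof (cases "s = 0")
      case True
      \<comment> \<open>With \<open>s = 0\<close> the roles of \<open>a\<close> and \<open>b\<close>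
        are simply exchanged.\<close>
      have "br a (br b a) = - br a c" unfolding c_def by (subst br_anticommute[of b a]) (rule br_minus_right)
      then have "br a (br b a) \<in> L3" using s True subspace_neg[OF sub(1)] by simp
      then show ?thesis using ab by (intro jac) (simp_all add: insert_commute)
    next
      case False
      \<comment> \<open>The coefficient \<open>t / s\<close> cancels the component of [b, c] along
        \<open>p\<close>, while [a, b'] is still \<open>c\<close>.\<close>
      define b' where "b' = b - scale (t / s) a"
      have "br a b' = c" by (simp add: b'_def c_def br_linear)
      then have "br b' (br a b') = (br b c - scale t p) - scale (t / s) (br a c - scale s p)"
        using False by (simp add: b'_def br_linear scale_right_diff_distrib)
      then have 1: "br b' (br a b') \<in> L3" using s t sub(1) by (metis subspace_diff subspace_scale)
      have "b = b' + scale (t / s) a" by (simp add: b'_def)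
      then have "b \<in> span ({a, b'} \<union> L1)" by (simp add: span_add span_scale span_base)
      then have "{a, b} \<union> L1 \<subseteq> span ({a, b'} \<union> L1)" by (auto intro: span_base)
      then have "span ({a, b'} \<union> L1) = UNIV" using ab span_minimal subspace_span by blast
      then show ?thesis using 1 by (rule jac)
    qed
  qed
qed

text \<open>If \<open>L3\<close> is zero, then \<open>L2\<close> is nonzero and \<open>L1/L2\<close>
  is not one-dimensional, as \<open>L1\<close> would be abelian; this leaves 3, 1, 0. If
  \<open>L3\<close> is nonzero, strict decrease from at most 3 forces 3, 2, 1, 0.\<close>

lemma non_malcev_dims:
  assumes "\<not> malcev_algebra scale br"
  shows "dim L1 = 3" "dim L2 = 1 \<and> L3 = {0} \<or> dim L2 = 2 \<and> dim L3 = 1 \<and> L4 = {0}"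
proof -
  have dims: "dim L2 \<le> dim L1 - 1" "dim L3 \<le> dim L2 - 1" "dim L4 \<le> dim L3 - 1"
    by (rule dim_lower_central_decreasing)+
  have "dim L1 \<noteq> 4" using malcev_if_dim_L1_4 assms by blast
  then have L1: "dim L1 \<le> 3" using dim_L1_le by linarith
  have no_cyclic: "dim L1 \<noteq> Suc (dim L2)" if L3: "L3 = {0}"
  proof
    assume "dim L1 = Suc (dim L2)"
    then obtain u where u: "span ({u} \<union> L2) = L1"
      by (rule subspace_complement_1[OF subspace_lower_central subspace_lower_central
            lower_central_Suc_subset])
    have "br x y = 0" if "x \<in> L1" "y \<in> L1" for x y
      by (rule L1_abelian_if_cyclic[OF L3 _ that, of u]) (simp only: flip: u, simp)
    then have "malcev_algebra scale br" by (rule malcev_if_L1_abelian[OF L3])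
    with assms show False by (rule notE)
  qed
  have no_L2: "dim L2 \<noteq> 0"
  proof
    assume "dim L2 = 0"
    then have L2: "L2 = {0}" by (simp only: dim_lower_central_eq_0)
    have "dim L3 = 0" using dims(2) \<open>dim L2 = 0\<close> by linarith
    then have "L3 = {0}" by (simp only: dim_lower_central_eq_0)
    then have "malcev_algebra scale br"
      by (rule malcev_if_L1_abelian) (rule lower_central_central(1)[OF L2])
    with assms show False by (rule notE)
  qed
  have L3: "dim L3 = 0 \<Longrightarrow> L3 = {0}" and L4: "dim L4 = 0 \<Longrightarrow> L4 = {0}"
    by (simp_all only: dim_lower_central_eq_0)
  have "dim L1 = 3 \<and> (dim L2 = 1 \<and> dim L3 = 0 \<or> dim L2 = 2 \<and> dim L3 = 1 \<and> dim L4 = 0)"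
  proof (cases "dim L3 = 0")
    case True
    then have "dim L1 \<noteq> Suc (dim L2)" using no_cyclic L3 by blast
    then have "dim L2 = 1" "dim L1 = 3" using dims(1) L1 no_L2 by linarith+
    then show ?thesis using True by blast
  next
    case False
    then have "dim L1 = 3" "dim L2 = 2" "dim L3 = 1" "dim L4 = 0" using dims L1 by linarith+
    then show ?thesis by blast
  qed
  then show "dim L1 = 3" "dim L2 = 1 \<and> L3 = {0} \<or> dim L2 = 2 \<and> dim L3 = 1 \<and> L4 = {0}"
    using L3 L4 by metis+
qed

end

subsection \<open>The model algebras\<close>

lemma UNIV_6: "(UNIV :: 6 set) = {1, 2, 3, 4, 5, 6}"
proof -
  have "card {1, 2, 3, 4, 5, 6 :: 6} = 6" by simp
  then have "{1, 2, 3, 4, 5, 6 :: 6} = UNIV" by (intro card_subset_eq) simp_all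
  then show ?thesis by (rule sym)
qed

lemma forall_6: "(\<forall>i::6. P i) \<longleftrightarrow> P 1 \<and> P 2 \<and> P 3 \<and> P 4 \<and> P 5 \<and> P 6"
  using UNIV_6 by (metis UNIV_I empty_iff insert_iff)

lemma sum_6: "sum f (UNIV :: 6 set) = f 1 + f 2 + f 3 + f 4 + f 5 + f 6"
  unfolding UNIV_6 by (simp add: add.assoc)

lemma B61_components:
  "B61 \<alpha> x y $ 1 = 0" "B61 \<alpha> x y $ 2 = 0" "B61 \<alpha> x y $ 3 = 0"
  "B61 \<alpha> x y $ 4 = x $ 1 * y $ 2 - x $ 2 * y $ 1"
  "B61 \<alpha> x y $ 5 = x $ 1 * y $ 3 - x $ 3 * y $ 1"
  "B61 \<alpha> x y $ 6 = \<alpha> * (x $ 2 * y $ 3 - x $ 3 * y $ 2) + (x $ 4 * y $ 5 - x $ 5 * y $ 4)"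
  by (simp_all add: B61_def table_product_def sum_6 axis_def algebra_simps)

lemma B62_components:
  "B62 x y $ 1 = 0" "B62 x y $ 2 = 0"
  "B62 x y $ 3 = x $ 1 * y $ 2 - x $ 2 * y $ 1" "B62 x y $ 4 = 0"
  "B62 x y $ 5 = x $ 3 * y $ 4 - x $ 4 * y $ 3"
  "B62 x y $ 6 = x $ 4 * y $ 5 - x $ 5 * y $ 4"
  by (simp_all add: B62_def table_product_def sum_6 axis_def algebra_simps)

lemma B63_components:
  "B63 x y $ 1 = 0" "B63 x y $ 2 = 0"
  "B63 x y $ 3 = x $ 1 * y $ 2 - x $ 2 * y $ 1" "B63 x y $ 4 = 0"
  "B63 x y $ 5 = x $ 3 * y $ 4 - x $ 4 * y $ 3"
  "B63 x y $ 6 = (x $ 1 * y $ 3 - x $ 3 * y $ 1) + (x $ 4 * y $ 5 - x $ 5 * y $ 4)"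
  by (simp_all add: B63_def table_product_def sum_6 axis_def algebra_simps)

text \<open>Packages six vectors as a family over the index type, as the comparison with a
  multiplication table requires.\<close>

lemma family_6:
  obtains e :: "6 \<Rightarrow> 'b" where "e 1 = e1" "e 2 = e2" "e 3 = e3" "e 4 = e4" "e 5 = e5" "e 6 = e6"
    "range e = {e1, e2, e3, e4, e5, e6}"
proof
  let ?e = "\<lambda>i::6. if i = 1 then e1 else if i = 2 then e2 else if i = 3 then e3
    else if i = 4 then e4 else if i = 5 then e5 else e6"
  show "range ?e = {e1, e2, e3, e4, e5, e6}" unfolding UNIV_6 by (simp add: insert_commute)
qed simp_all

text \<open>Six spanning vectors in dimension six form a basis. The map \<open>g\<close> from
  coordinates to vectors is bijective and respects products on basis vectors, so its inverse is the
  isomorphism.\<close>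

lemma (in nonassoc_algebra) alg_isomorphic_table_product:
  fixes e :: "6 \<Rightarrow> 'b"
  assumes dim: "dim UNIV = 6" and span: "span (range e) = UNIV"
    and table: "\<forall>i j. br (e i) (e j) = (\<Sum>k\<in>UNIV. scale ((t i j - t j i) $ k) (e k))"
  shows "alg_isomorphic scale br (*s) (table_product t)"
proof -
  define g where "g x = (\<Sum>k\<in>UNIV. scale (x $ k) (e k))" for x :: "'a ^ 6"
  \<comment> \<open>A maximal independent subset is a basis and has six elements, so it exhausts
    \<open>range e\<close>, and \<open>e\<close> has no repetitions.\<close>
  obtain B where B: "B \<subseteq> range e" "independent B" "range e \<subseteq> span B"
    using maximal_independent_subset[of "range e"] by blast
  have "span B = UNIV" using B(3) span span_minimal subspace_span by blast
  then have "card B = 6" using basis_card_eq_dim[of B UNIV] B(2) dim by simp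
  have "card (range e) \<le> card (UNIV :: 6 set)" by (rule card_image_le) simp
  then have le: "card (range e) \<le> 6" by simp
  have "B = range e" using B(1) le \<open>card B = 6\<close> by (intro card_seteq) simp_all
  then have ind: "independent (range e)" and "card (range e) = card (UNIV :: 6 set)"
    using B(2) \<open>card B = 6\<close> by simp_all
  then have inj: "inj e" by (intro eq_card_imp_inj_on) simp_all
  have g_add: "g (x + y) = g x + g y" for x y
    by (simp add: g_def scale_left_distrib sum.distrib)
  have g_scale: "g (c *s x) = scale c (g x)" for c x
    by (simp add: g_def scale_sum_right)
  have g_sum: "g (\<Sum>i\<in>S. h i) = (\<Sum>i\<in>S. g (h i))" for h and S :: "6 set"
    by (induction S rule: infinite_finite_induct) (simp_all add: g_add, simp_all add: g_def)
  have "inj g"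
  proof (rule injI)
    fix x y assume "g x = g y"
    then have "(\<Sum>k\<in>UNIV. scale ((x - y) $ k) (e k)) = 0"
      by (simp add: g_def scale_left_diff_distrib sum_subtractf)
    then have "(\<Sum>v\<in>range e. scale ((x - y) $ (inv e v)) v) = 0"
      by (subst sum.reindex[OF inj]) (simp add: inv_f_f[OF inj])
    then have "(x - y) $ (inv e (e k)) = 0" for k
      by (rule independentD[OF ind _ _, rotated 2]) simp_all
    then show "x = y" by (simp add: inv_f_f[OF inj] vec_eq_iff)
  qed
  moreover have "surj g"
  proof (rule surjI)
    fix v
    have "v \<in> span (range e)" using span by simp
    then obtain u where "v = (\<Sum>w\<in>range e. scale (u w) w)"
      by (auto simp: span_finite)
    also have "\<dots> = g (\<chi> k. u (e k))"
      by (subst sum.reindex[OF inj]) (simp add: g_def)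
    finally show "g ((\<lambda>v. SOME x. g x = v) v) = v" by (metis (mono_tags) someI)
  qed
  ultimately have bij: "bij g" by (rule bijI)
  then have g_inv: "g (inv g v) = v" and inv_g: "inv g (g x) = x" for v x
    by (simp_all add: bij_is_surj surj_f_inv_f bij_is_inj)
  have br_sum: "br (\<Sum>i\<in>S. h i) y = (\<Sum>i\<in>S. br (h i) y)"
    "br y (\<Sum>i\<in>S. h i) = (\<Sum>i\<in>S. br y (h i))"
    for h y and S :: "6 set"
    by (induction S rule: infinite_finite_induct) (simp_all add: br_linear)
  have g_br: "g (table_product t x y) = br (g x) (g y)" for x y
  proof -
    have "g (table_product t x y) = (\<Sum>i\<in>UNIV. \<Sum>j\<in>UNIV. scale (x $ i * y $ j) (br (e i) (e j)))"
      by (simp add: table_product_def g_sum g_scale table)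
        (simp add: g_def scale_sum_right right_diff_distrib)
    also have "\<dots> = br (g x) (g y)"
      by (simp add: g_def br_sum br_linear scale_sum_right)
        (subst sum.swap, simp add: mult.commute)
    finally show ?thesis .
  qed
  have "Vector_Spaces.linear scale (*s) (inv g)"
  proof -
    have "inv g (u + v) = inv g u + inv g v" "inv g (scale c u) = c *s inv g u" for u v c
      using inv_g[of "inv g u + inv g v"] inv_g[of "c *s inv g u"] by (simp_all add: g_add g_scale g_inv)
    then show ?thesis
      using vector_space_axioms vec.vector_space_axioms
      by (simp add: Vector_Spaces.linear_def module_hom_def module_hom_axioms_def
          vector_space_def module_def)
  qed
  moreover have "bij (inv g)" using bij by (rule bij_imp_bij_inv)
  moreover have "inv g (br u v) = table_product t (inv g u) (inv g v)" for u v
    using inv_g[of "table_product t (inv g u) (inv g v)"] by (simp add: g_br g_inv)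
  ultimately show ?thesis unfolding alg_isomorphic_def by blast
qed

section \<open>Isomorphisms among the model algebras\<close>

lemma linear_vec_iff:
  "Vector_Spaces.linear (*s) (*s) (f :: 'a::field ^ 'm \<Rightarrow> 'a ^ 'n) \<longleftrightarrow>
    (\<forall>x y. f (x + y) = f x + f y) \<and> (\<forall>c x. f (c *s x) = c *s f x)"
  using vec.vector_space_axioms[where 'a = 'a and 'b = 'm]
    vec.vector_space_axioms[where 'a = 'a and 'b = 'n]
  by (simp add: Vector_Spaces.linear_def module_hom_def module_hom_axioms_def
      vector_space_def module_def)

lemma alg_isomorphic_vecE:
  fixes br1 :: "'a::field ^ 'm \<Rightarrow> 'a ^ 'm \<Rightarrow> 'a ^ 'm" and br2 :: "'a ^ 'n \<Rightarrow> 'a ^ 'n \<Rightarrow> 'a ^ 'n"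
  assumes "alg_isomorphic (*s) br1 (*s) br2"
  obtains f :: "'a ^ 'm \<Rightarrow> 'a ^ 'n" where "f 0 = 0" "\<forall>c x. f (c *s x) = c *s f x" "inj f" "surj f"
    "\<forall>x y. br2 (f x) (f y) = f (br1 x y)"
proof -
  obtain f :: "'a ^ 'm \<Rightarrow> 'a ^ 'n" where f: "Vector_Spaces.linear (*s) (*s) f" "bij f"
    "\<And>x y. f (br1 x y) = br2 (f x) (f y)"
    using assms unfolding alg_isomorphic_def by blast
  from f(1) have scale: "f (c *s x) = c *s f x" for c x by (simp add: linear_vec_iff)
  from scale[of 0 0] have "f 0 = 0" by simp
  then show thesis using that[of f] scale f(2,3) by (simp add: bij_def)
qed

lemma B61_isomorphic_scale:
  fixes \<alpha> l :: "'a::field"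
  assumes "l \<noteq> 0"
  shows "alg_isomorphic (*s) (B61 \<alpha>) (*s) (B61 (l\<^sup>2 * \<alpha>))"
proof -
  \<comment> \<open>Scaling \<open>e1\<close> by \<open>l\<close> scales \<open>e4\<close> and
    \<open>e5\<close> by \<open>l\<close>, hence \<open>e6\<close> = [e4, e5] by \<open>l\<close>
    squared; this multiplies the parameter by the same square.\<close>
  define d :: "6 \<Rightarrow> 'a" where "d k = (if k = 1 \<or> k = 4 \<or> k = 5 then l
    else if k = 6 then l\<^sup>2 else 1)" for k
  define f :: "'a ^ 6 \<Rightarrow> 'a ^ 6" where "f x = (\<chi> k. d k * x $ k)" for x
  have "Vector_Spaces.linear (*s) (*s) f"
    by (simp add: linear_vec_iff f_def vec_eq_iff algebra_simps)
  moreover have "bij f"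
    by (rule bij_betwI[of _ _ _ "\<lambda>x. \<chi> k. x $ k / d k"])
      (use assms in \<open>auto simp: f_def vec_eq_iff d_def\<close>)
  moreover have "f (B61 \<alpha> x y) = B61 (l\<^sup>2 * \<alpha>) (f x) (f y)" for x y
    unfolding vec_eq_iff forall_6
    by (simp add: B61_components f_def) (simp add: d_def power2_eq_square algebra_simps)
  ultimately show ?thesis unfolding alg_isomorphic_def by blast
qed

text \<open>The images \<open>E k\<close> satisfy the table of the source. Comparing coordinates
  makes the map triangular enough that the sixth coordinate of [E 2, E 3] relates the parameters,
  with \<open>l\<close> the first coordinate of \<open>E 1\<close>.\<close>

lemma B61_isomorphic_imp:
  fixes \<alpha> \<beta> :: "'a::field"
  assumes "alg_isomorphic (*s) (B61 \<alpha>) (*s) (B61 \<beta>)"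
  shows "\<exists>l. l \<noteq> 0 \<and> \<beta> = l\<^sup>2 * \<alpha>"
proof -
  obtain f :: "'a ^ 6 \<Rightarrow> 'a ^ 6" where f: "f 0 = 0" "\<forall>c x. f (c *s x) = c *s f x"
    "inj f" "surj f" "\<forall>x y. B61 \<beta> (f x) (f y) = f (B61 \<alpha> x y)"
    by (rule alg_isomorphic_vecE[OF assms])
  define E where "E k = f (evec k)" for k
  have prods: "B61 \<beta> (E 1) (E 2) = E 4" "B61 \<beta> (E 1) (E 3) = E 5" "B61 \<beta> (E 2) (E 3) = \<alpha> *s E 6"
    "B61 \<beta> (E 4) (E 5) = E 6" "B61 \<beta> (E 2) (E 4) = 0" "B61 \<beta> (E 2) (E 5) = 0"
  proof -
    have "B61 \<alpha> (evec 1) (evec 2) = evec 4" "B61 \<alpha> (evec 1) (evec 3) = evec 5"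
      "B61 \<alpha> (evec 2) (evec 3) = \<alpha> *s evec 6" "B61 \<alpha> (evec 4) (evec 5) = evec 6"
      "B61 \<alpha> (evec 2) (evec 4) = 0" "B61 \<alpha> (evec 2) (evec 5) = 0"
      by (simp_all add: vec_eq_iff forall_6 B61_components axis_def)
    then show "B61 \<beta> (E 1) (E 2) = E 4" "B61 \<beta> (E 1) (E 3) = E 5"
      "B61 \<beta> (E 2) (E 3) = \<alpha> *s E 6" "B61 \<beta> (E 4) (E 5) = E 6"
      "B61 \<beta> (E 2) (E 4) = 0" "B61 \<beta> (E 2) (E 5) = 0"
      by (simp_all add: E_def f)
  qed
  have "E 6 \<noteq> 0"
    using f(3) f(1) unfolding E_def by (metis axis_eq_0_iff injD zero_neq_one)
  have comps: "E 4 $ 1 = 0" "E 4 $ 2 = 0" "E 4 $ 3 = 0"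
    "E 4 $ 4 = E 1 $ 1 * E 2 $ 2 - E 1 $ 2 * E 2 $ 1" "E 4 $ 5 = E 1 $ 1 * E 2 $ 3 - E 1 $ 3 * E 2 $ 1"
    "E 5 $ 1 = 0" "E 5 $ 2 = 0" "E 5 $ 3 = 0"
    "E 5 $ 4 = E 1 $ 1 * E 3 $ 2 - E 1 $ 2 * E 3 $ 1" "E 5 $ 5 = E 1 $ 1 * E 3 $ 3 - E 1 $ 3 * E 3 $ 1"
    by (simp_all add: B61_components flip: prods(1,2))
  have E6: "E 6 $ 1 = 0" "E 6 $ 2 = 0" "E 6 $ 3 = 0" "E 6 $ 4 = 0" "E 6 $ 5 = 0"
    "E 6 $ 6 = E 4 $ 4 * E 5 $ 5 - E 4 $ 5 * E 5 $ 4"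
    by (simp_all add: B61_components comps(1-3,6-8) flip: prods(4))
  define \<Delta> where "\<Delta> = E 2 $ 2 * E 3 $ 3 - E 2 $ 3 * E 3 $ 2"
  have r4: "E 2 $ 1 * E 3 $ 2 - E 2 $ 2 * E 3 $ 1 = 0"
    using arg_cong[OF prods(3), of "\<lambda>v. v $ 4"] E6 by (simp add: B61_components)
  have r5: "E 2 $ 1 * E 3 $ 3 - E 2 $ 3 * E 3 $ 1 = 0"
    using arg_cong[OF prods(3), of "\<lambda>v. v $ 5"] E6 by (simp add: B61_components)
  \<comment> \<open>The parenthesis is the 3 by 3 determinant of the leading coordinates of
    \<open>E 1\<close>, \<open>E 2\<close>, \<open>E 3\<close>, expanded along \<open>E 1\<close>;
    two of its minors vanish by \<open>r4\<close> and \<open>r5\<close>.\<close>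
  have "E 6 $ 6 = E 1 $ 1 * (E 1 $ 1 * \<Delta> - E 1 $ 2 * (E 2 $ 1 * E 3 $ 3 - E 2 $ 3 * E 3 $ 1)
      + E 1 $ 3 * (E 2 $ 1 * E 3 $ 2 - E 2 $ 2 * E 3 $ 1))"
    unfolding E6(6) comps \<Delta>_def by (simp add: algebra_simps)
  then have E66: "E 6 $ 6 = (E 1 $ 1)\<^sup>2 * \<Delta>" unfolding r4 r5 by (simp add: power2_eq_square)
  have "E 6 $ 6 \<noteq> 0"
  proof
    assume "E 6 $ 6 = 0"
    then have "E 6 = 0" unfolding vec_eq_iff forall_6 using E6(1-5) by simp
    with \<open>E 6 \<noteq> 0\<close> show False ..
  qed
  then have nz: "E 1 $ 1 \<noteq> 0" "\<Delta> \<noteq> 0" using E66 by auto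
  have "E 2 $ 1 * \<Delta> = E 2 $ 2 * (E 2 $ 1 * E 3 $ 3 - E 2 $ 3 * E 3 $ 1)
      - E 2 $ 3 * (E 2 $ 1 * E 3 $ 2 - E 2 $ 2 * E 3 $ 1)"
    unfolding \<Delta>_def by (simp add: algebra_simps)
  then have y1: "E 2 $ 1 = 0" unfolding r4 r5 using nz by simp
  have "E 3 $ 1 * \<Delta> = E 3 $ 2 * (E 2 $ 1 * E 3 $ 3 - E 2 $ 3 * E 3 $ 1)
      - E 3 $ 3 * (E 2 $ 1 * E 3 $ 2 - E 2 $ 2 * E 3 $ 1)"
    unfolding \<Delta>_def by (simp add: algebra_simps)
  then have z1: "E 3 $ 1 = 0" unfolding r4 r5 using nz by simp
  have q4: "E 2 $ 4 * E 2 $ 3 - E 2 $ 5 * E 2 $ 2 = 0"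
    using arg_cong[OF prods(5), of "\<lambda>v. v $ 6"] nz
    by (simp add: B61_components comps y1 z1 algebra_simps)
  have q5: "E 2 $ 4 * E 3 $ 3 - E 2 $ 5 * E 3 $ 2 = 0"
    using arg_cong[OF prods(6), of "\<lambda>v. v $ 6"] nz
    by (simp add: B61_components comps y1 z1 algebra_simps)
  \<comment> \<open>Cramer's rule: \<open>q4\<close> and \<open>q5\<close> are linear equations in
    the fourth and fifth coordinates of \<open>E 2\<close> with determinant \<Delta>.\<close>
  have "E 2 $ 4 * \<Delta> = E 2 $ 2 * (E 2 $ 4 * E 3 $ 3 - E 2 $ 5 * E 3 $ 2)
      - E 3 $ 2 * (E 2 $ 4 * E 2 $ 3 - E 2 $ 5 * E 2 $ 2)"
    unfolding \<Delta>_def by (simp add: algebra_simps)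
  then have y4: "E 2 $ 4 = 0" unfolding q4 q5 using nz by simp
  have "E 2 $ 5 * \<Delta> = E 2 $ 3 * (E 2 $ 4 * E 3 $ 3 - E 2 $ 5 * E 3 $ 2)
      - E 3 $ 3 * (E 2 $ 4 * E 2 $ 3 - E 2 $ 5 * E 2 $ 2)"
    unfolding \<Delta>_def by (simp add: algebra_simps)
  then have y5: "E 2 $ 5 = 0" unfolding q4 q5 using nz by simp
  have "\<beta> * \<Delta> = \<alpha> * ((E 1 $ 1)\<^sup>2 * \<Delta>)"
    using arg_cong[OF prods(3), of "\<lambda>v. v $ 6"]
    by (simp add: B61_components y4 y5 E66 \<Delta>_def)
  then have "\<beta> = (E 1 $ 1)\<^sup>2 * \<alpha>" using nz(2) by simp
  then show ?thesis using nz(1) by blast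
qed

lemma B61_triple_product: "B61 \<alpha> (B61 \<alpha> (B61 \<alpha> x y) z) w = 0"
  unfolding vec_eq_iff forall_6 by (simp add: B61_components)

text \<open>The invariant is the length of the lower central series: products of this shape vanish
  in \<open>B61\<close>, while [[[e1, e2], e4], e4] = -e6 in both other algebras.\<close>

lemma B61_not_isomorphic:
  fixes br2 :: "'a::field ^ 'n \<Rightarrow> 'a ^ 'n \<Rightarrow> 'a ^ 'n"
  assumes "br2 (br2 (br2 x y) z) w \<noteq> 0"
  shows "\<not> alg_isomorphic (*s) (B61 \<alpha>) (*s) br2"
proof
  assume "alg_isomorphic (*s) (B61 \<alpha>) (*s) br2"
  then obtain f :: "'a ^ 6 \<Rightarrow> 'a ^ 'n" where f: "f 0 = 0" "\<forall>c x. f (c *s x) = c *s f x"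
    "inj f" "surj f" "\<forall>x y. br2 (f x) (f y) = f (B61 \<alpha> x y)"
    by (rule alg_isomorphic_vecE)
  obtain x' y' z' w' where "x = f x'" "y = f y'" "z = f z'" "w = f w'"
    using f(4) by (metis surjD)
  then show False using assms by (simp add: f B61_triple_product)
qed

lemma B61_not_isomorphic_B62: "\<not> alg_isomorphic (*s) (B61 (\<alpha> :: 'a::field)) (*s) B62"
proof (rule B61_not_isomorphic)
  have "B62 (B62 (B62 (evec 1) (evec 2)) (evec 4)) (evec 4) $ 6 \<noteq> (0 :: 'a) "
    by (simp add: B62_components axis_def)
  then show "B62 (B62 (B62 (evec 1) (evec 2)) (evec 4)) (evec 4) \<noteq> (0 :: 'a ^ 6)" by force
qed

lemma B61_not_isomorphic_B63: "\<not> alg_isomorphic (*s) (B61 (\<alpha> :: 'a::field)) (*s) B63"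
proof (rule B61_not_isomorphic)
  have "B63 (B63 (B63 (evec 1) (evec 2)) (evec 4)) (evec 4) $ 6 \<noteq> (0 :: 'a) "
    by (simp add: B63_components axis_def)
  then show "B63 (B63 (B63 (evec 1) (evec 2)) (evec 4)) (evec 4) \<noteq> (0 :: 'a ^ 6)" by force
qed

text \<open>In \<open>B62\<close> both \<open>e1\<close> and \<open>e2\<close> annihilate [e1, e2].
  In \<open>B63\<close> two vectors annihilating their product have a product without
  \<open>e3\<close> component, and then the image of \<open>e6\<close> would be zero.\<close>

lemma B62_not_isomorphic_B63: "\<not> alg_isomorphic (*s) (B62 :: 'a::field ^ 6 \<Rightarrow> _) (*s) B63"
proof
  assume "alg_isomorphic (*s) (B62 :: 'a ^ 6 \<Rightarrow> _) (*s) B63"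
  then obtain f :: "'a ^ 6 \<Rightarrow> 'a ^ 6" where f: "f 0 = 0" "\<forall>c x. f (c *s x) = c *s f x"
    "inj f" "surj f" "\<forall>x y. B63 (f x) (f y) = f (B62 x y)"
    by (rule alg_isomorphic_vecE)
  define E where "E k = f (evec k)" for k
  have prods: "B63 (E 1) (E 2) = E 3" "B63 (E 3) (E 4) = E 5" "B63 (E 4) (E 5) = E 6"
    "B63 (E 1) (E 3) = 0" "B63 (E 2) (E 3) = 0"
  proof -
    have "B62 (evec 1) (evec 2) = (evec 3 :: 'a ^ 6)" "B62 (evec 3) (evec 4) = (evec 5 :: 'a ^ 6)"
      "B62 (evec 4) (evec 5) = (evec 6 :: 'a ^ 6)" "B62 (evec 1) (evec 3) = (0 :: 'a ^ 6)"
      "B62 (evec 2) (evec 3) = (0 :: 'a ^ 6)"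
      by (simp_all add: vec_eq_iff forall_6 B62_components axis_def)
    then show "B63 (E 1) (E 2) = E 3" "B63 (E 3) (E 4) = E 5" "B63 (E 4) (E 5) = E 6"
      "B63 (E 1) (E 3) = 0" "B63 (E 2) (E 3) = 0"
      by (simp_all add: E_def f)
  qed
  have "E 6 \<noteq> 0"
    using f(3) f(1) unfolding E_def by (metis axis_eq_0_iff injD zero_neq_one)
  have E3: "E 3 $ 1 = 0" "E 3 $ 2 = 0" "E 3 $ 4 = 0" "E 3 $ 3 = E 1 $ 1 * E 2 $ 2 - E 1 $ 2 * E 2 $ 1"
    by (simp_all add: B63_components flip: prods(1))
  have "E 3 $ 3 = 0"
  proof (rule ccontr)
    assume nz: "E 3 $ 3 \<noteq> 0"
    \<comment> \<open>The fifth coordinates of the two zero products remove the fourth coordinates;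
      the sixth ones then remove the first coordinates, which makes the minor \<open>E 3 $ 3\<close>
      zero.\<close>
    have "E 1 $ 4 = 0" "E 2 $ 4 = 0"
      using arg_cong[OF prods(4), of "\<lambda>v. v $ 5"] arg_cong[OF prods(5), of "\<lambda>v. v $ 5"] nz E3(1-3)
      by (simp_all add: B63_components)
    then have "E 1 $ 1 = 0" "E 2 $ 1 = 0"
      using arg_cong[OF prods(4), of "\<lambda>v. v $ 6"] arg_cong[OF prods(5), of "\<lambda>v. v $ 6"] nz E3(1-3)
      by (simp_all add: B63_components)
    then show False using nz E3(4) by simp
  qed
  then have "E 5 $ k = 0" if "k \<noteq> 6" for k
  proof -
    have "\<forall>k. k \<noteq> 6 \<longrightarrow> E 5 $ k = 0"
      unfolding forall_6 using E3(1-3) \<open>E 3 $ 3 = 0\<close>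
      by (simp add: B63_components flip: prods(2))
    then show ?thesis using that by blast
  qed
  then have "E 6 = 0"
    unfolding vec_eq_iff forall_6 by (simp add: B63_components flip: prods(3))
  with \<open>E 6 \<noteq> 0\<close> show False ..
qed

subsection \<open>Recognizing the model algebras\<close>

context nonassoc_algebra
begin

lemmas lower_central_closed =
  subspace_0[OF subspace_lower_central] subspace_add[OF subspace_lower_central]
  subspace_diff[OF subspace_lower_central] subspace_neg[OF subspace_lower_central]
  subspace_scale[OF subspace_lower_central]

lemma span_eq_UNIV_trans:
  assumes "span X = UNIV" "X \<subseteq> span Y"
  shows "span Y = UNIV"
  using assms span_minimal[OF assms(2) subspace_span] by blast

lemma in_span_cancel: "x - y \<in> span Y \<Longrightarrow> y \<in> span Y \<Longrightarrow> x \<in> span Y"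
  using span_add[of "x - y" Y y] by simp

lemma span_shift_3:
  assumes "span ({x, y, z} \<union> lower_central n) = UNIV"
    and "x - x' \<in> lower_central n" "y - y' \<in> lower_central n" "z - z' \<in> lower_central n"
  shows "span ({x', y', z'} \<union> lower_central n) = UNIV"
proof (rule span_eq_UNIV_trans[OF assms(1)])
  let ?Y = "{x', y', z'} \<union> lower_central n"
  have "w \<in> span ?Y" if "w - w' \<in> lower_central n" "w' \<in> ?Y" for w w'
    by (rule in_span_cancel[of w w']) (use that in \<open>auto intro: span_base\<close>)
  from this[OF assms(2)] this[OF assms(3)] this[OF assms(4)]
  have "x \<in> span ?Y" "y \<in> span ?Y" "z \<in> span ?Y" by simp_all
  moreover have "lower_central n \<subseteq> span ?Y" using span_superset[of ?Y] by blast
  ultimately show "{x, y, z} \<union> lower_central n \<subseteq> span ?Y" by simp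
qed

end

context anticommutative_algebra
begin

lemma three_generators_L1:
  assumes "span ({x, y, z} \<union> L1) = UNIV"
  shows "L1 \<subseteq> span ({br x y, br x z, br y z} \<union> L2)"
proof (rule lower_central_Suc_minimal[of _ "{x, y, z} \<union> L1" "{x, y, z} \<union> L1"])
  let ?T = "span ({br x y, br x z, br y z} \<union> L2)"
  have 1: "br x y \<in> ?T" "br x z \<in> ?T" "br y z \<in> ?T" by (simp_all add: span_base)
  have 2: "br y x \<in> ?T" "br z x \<in> ?T" "br z y \<in> ?T"
    unfolding br_anticommute[of y x] br_anticommute[of z x] br_anticommute[of z y]
    by (rule span_neg[OF 1(1)] span_neg[OF 1(2)] span_neg[OF 1(3)])+
  have "L2 \<subseteq> ?T" using span_superset[of "{br x y, br x z, br y z} \<union> L2"] by blast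
  then have 3: "br u v \<in> ?T" "br v u \<in> ?T" if "u \<in> L1" for u v
    using that br_left_lower_central br_right_lower_central by blast+
  show "br u v \<in> ?T" if "u \<in> {x, y, z} \<union> L1" "v \<in> {x, y, z} \<union> L1" for u v
    using that 1 2 3 span_zero by (elim UnE insertE emptyE) (simp_all only: br_self)
qed (use assms in auto)

lemma alg_isomorphic_B61:
  assumes dim: "dim UNIV = 6" and span: "span {e1, e2, e3, e4, e5, e6} = UNIV"
    and prods: "br e1 e2 = e4" "br e1 e3 = e5" "br e2 e3 = scale \<alpha> e6" "br e4 e5 = e6"
    and zeros: "br e1 e4 = 0" "br e1 e5 = 0" "br e1 e6 = 0" "br e2 e4 = 0" "br e2 e5 = 0"
      "br e2 e6 = 0" "br e3 e4 = 0" "br e3 e5 = 0" "br e3 e6 = 0" "br e4 e6 = 0" "br e5 e6 = 0"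
  shows "alg_isomorphic scale br (*s) (B61 \<alpha>)"
proof -
  obtain e :: "6 \<Rightarrow> 'b" where e: "e 1 = e1" "e 2 = e2" "e 3 = e3" "e 4 = e4" "e 5 = e5" "e 6 = e6"
    and range: "range e = {e1, e2, e3, e4, e5, e6}"
    by (rule family_6)
  \<comment> \<open>Negating every entry and folding anticommutativity supplies the products in
    reversed order.\<close>
  note anti = prods zeros prods[THEN arg_cong[of _ _ uminus], folded br_anticommute]
    zeros[THEN arg_cong[of _ _ uminus], folded br_anticommute]
  show ?thesis unfolding B61_def
    by (rule alg_isomorphic_table_product[of e], rule dim, simp only: range span,
        unfold forall_6 sum_6 e, simp add: axis_def anti)
qed

lemma alg_isomorphic_B62:
  assumes dim: "dim UNIV = 6" and span: "span {e1, e2, e3, e4, e5, e6} = UNIV"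
    and prods: "br e1 e2 = e3" "br e3 e4 = e5" "br e4 e5 = e6"
    and zeros: "br e1 e3 = 0" "br e1 e4 = 0" "br e1 e5 = 0" "br e1 e6 = 0" "br e2 e3 = 0" "br e2 e4 = 0"
      "br e2 e5 = 0" "br e2 e6 = 0" "br e3 e5 = 0" "br e3 e6 = 0" "br e4 e6 = 0" "br e5 e6 = 0"
  shows "alg_isomorphic scale br (*s) B62"
proof -
  obtain e :: "6 \<Rightarrow> 'b" where e: "e 1 = e1" "e 2 = e2" "e 3 = e3" "e 4 = e4" "e 5 = e5" "e 6 = e6"
    and range: "range e = {e1, e2, e3, e4, e5, e6}"
    by (rule family_6)
  note anti = prods zeros prods[THEN arg_cong[of _ _ uminus], folded br_anticommute]
    zeros[THEN arg_cong[of _ _ uminus], folded br_anticommute]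
  show ?thesis unfolding B62_def
    by (rule alg_isomorphic_table_product[of e], rule dim, simp only: range span,
        unfold forall_6 sum_6 e, simp add: axis_def anti)
qed

lemma alg_isomorphic_B63:
  assumes dim: "dim UNIV = 6" and span: "span {e1, e2, e3, e4, e5, e6} = UNIV"
    and prods: "br e1 e2 = e3" "br e3 e4 = e5" "br e1 e3 = e6" "br e4 e5 = e6"
    and zeros: "br e1 e4 = 0" "br e1 e5 = 0" "br e1 e6 = 0" "br e2 e3 = 0" "br e2 e4 = 0"
      "br e2 e5 = 0" "br e2 e6 = 0" "br e3 e5 = 0" "br e3 e6 = 0" "br e4 e6 = 0" "br e5 e6 = 0"
  shows "alg_isomorphic scale br (*s) B63"
proof -
  obtain e :: "6 \<Rightarrow> 'b" where e: "e 1 = e1" "e 2 = e2" "e 3 = e3" "e 4 = e4" "e 5 = e5" "e 6 = e6"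
    and range: "range e = {e1, e2, e3, e4, e5, e6}"
    by (rule family_6)
  note anti = prods zeros prods[THEN arg_cong[of _ _ uminus], folded br_anticommute]
    zeros[THEN arg_cong[of _ _ uminus], folded br_anticommute]
  show ?thesis unfolding B63_def
    by (rule alg_isomorphic_table_product[of e], rule dim, simp only: range span,
        unfold forall_6 sum_6 e, simp add: axis_def anti)
qed

end

subsection \<open>Central \<open>L\<^sub>2\<close>\<close>

context nilpotent_binary_lie_6
begin

lemma exists_three_generators:
  assumes "dim L1 = 3"
  obtains x y z where "span ({x, y, z} \<union> L1) = UNIV"
proof -
  obtain x y z where "span ({x, y, z} \<union> L1) = lower_central 0"
    by (rule subspace_complement_3[OF subspace_lower_central subspace_lower_central lower_central_Suc_subset, of 0])
      (use assms dim_UNIV_6 in simp_all)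
  then show thesis using that by simp
qed

lemma lower_central_eq_span_insert:
  assumes "dim (lower_central n) = Suc (dim (lower_central (Suc n)))"
    and "u \<in> lower_central n" "u \<notin> lower_central (Suc n)"
  shows "span ({u} \<union> lower_central (Suc n)) = lower_central n"
proof (rule subspace_dim_equal)
  show "span ({u} \<union> lower_central (Suc n)) \<subseteq> lower_central n"
    using assms(2) lower_central_Suc_subset[of n]
    by (intro span_minimal subspace_lower_central) simp
  show "dim (lower_central n) \<le> dim (span ({u} \<union> lower_central (Suc n)))"
    using assms by (simp add: dim_insert)
qed (simp_all add: subspace_lower_central)

lemma span_cyclic_obtain:
  assumes "x \<in> span ({u} \<union> lower_central n)"
  obtains s where "x - scale s u \<in> lower_central n"
  using assms by (auto simp: span_insert)

text \<open>The product gives a map from the exterior square of the three-dimensional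
  \<open>A/L1\<close> to the two-dimensional \<open>L1/L2\<close>. It has a nonzero kernel, and in
  dimension three every bivector is decomposable; the cases exhibit the two factors.\<close>

lemma exists_commuting_generators:
  assumes "dim L1 = 3" "dim L2 = 1"
  obtains x y z where "span ({x, y, z} \<union> L1) = UNIV" "br y z \<in> L2"
proof -
  obtain x y z where gen: "span ({x, y, z} \<union> L1) = UNIV"
    using exists_three_generators assms(1) by blast
  define S where "S = span ({br x y} \<union> L2)"
  consider "br x y \<in> L2" | "br x z \<in> S" | "br x y \<notin> L2" "br x z \<notin> S" by blast
  then show thesis
  proof cases
    case 1
    have "span ({z, x, y} \<union> L1) = UNIV" using gen by (simp add: insert_commute)
    then show thesis using 1 by (rule that)
  next
    case 2
    then obtain s where s: "br x z - scale s (br x y) \<in> L2"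
      unfolding S_def by (rule span_cyclic_obtain)
    show thesis
    proof (rule that)
      show "br x (z - scale s y) \<in> L2" using s by (simp add: br_linear)
      show "span ({y, x, z - scale s y} \<union> L1) = UNIV" (is "span ?Y = _")
      proof (rule span_eq_UNIV_trans[OF gen])
        have "x \<in> span ?Y" "y \<in> span ?Y" by (simp_all add: span_base)
        moreover have "z \<in> span ?Y"
          by (rule in_span_cancel[of z "z - scale s y"])
            (use \<open>y \<in> span ?Y\<close> in \<open>simp_all add: span_scale span_base\<close>)
        moreover have "L1 \<subseteq> span ?Y" using span_superset[of ?Y] by blast
        ultimately show "{x, y, z} \<union> L1 \<subseteq> span ?Y" by simp
      qed
    qed
  next
    case 3
    have sub: "subspace S" by (simp add: S_def)
    have dS: "dim S = 2"
      using 3(1) assms(2) by (simp add: S_def dim_insert)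
    have dT: "dim (span ({br x z} \<union> S)) = 3"
      using 3(2) dS sub by (simp add: dim_insert span_eq_iff[THEN iffD2])
    have SL: "S \<subseteq> L1" unfolding S_def
      using lower_central_Suc_subset[of "Suc 0"]
      by (intro span_minimal subspace_lower_central) (simp add: br_in_lower_central_1)
    have "span ({br x z} \<union> S) = L1"
    proof (rule subspace_dim_equal)
      show "span ({br x z} \<union> S) \<subseteq> L1"
        using SL by (intro span_minimal subspace_lower_central) (simp add: br_in_lower_central_1)
    qed (simp_all only: dT assms(1) subspace_span subspace_lower_central order_refl)
    then have "br y z \<in> span ({br x z} \<union> S)" using br_in_lower_central_1 by simp
    then obtain t where "br y z - scale t (br x z) \<in> S"
      using sub by (auto simp: span_insert span_eq_iff[THEN iffD2])
    \<comment> \<open>Now [x, y] and [x, z] span \<open>L1\<close> modulo \<open>L2\<close>, and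
      [y, z] is expressed through them; its coefficients are the multiples of \<open>x\<close> by
      which \<open>y\<close> and \<open>z\<close> must be shifted.\<close>
    then obtain s where s: "br y z - scale t (br x z) - scale s (br x y) \<in> L2"
      unfolding S_def by (rule span_cyclic_obtain)
    show thesis
    proof (rule that)
      have "br (y - scale t x) (z + scale s x) = br y z - scale t (br x z) - scale s (br x y)"
        by (simp add: br_linear br_anticommute[of y x])
      then show "br (y - scale t x) (z + scale s x) \<in> L2" using s by (simp only:)
      show "span ({x, y - scale t x, z + scale s x} \<union> L1) = UNIV" (is "span ?Y = _")
      proof (rule span_eq_UNIV_trans[OF gen])
        have x: "x \<in> span ?Y" by (simp_all add: span_base)
        moreover have "y \<in> span ?Y"
          by (rule in_span_cancel[of y "y - scale t x"])
            (use x in \<open>simp_all add: span_scale span_base\<close>)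
        moreover have "z \<in> span ?Y"
          by (rule in_span_cancel[of z "z + scale s x"])
            (use x in \<open>simp_all add: span_scale span_base span_neg\<close>)
        moreover have "L1 \<subseteq> span ?Y" using span_superset[of ?Y] by blast
        ultimately show "{x, y, z} \<union> L1 \<subseteq> span ?Y" by simp
      qed
    qed
  qed
qed

lemma isomorphic_B61:
  assumes "\<not> malcev_algebra scale br" "dim L1 = 3" "dim L2 = 1" and L3: "L3 = {0}"
  shows "\<exists>\<alpha>. alg_isomorphic scale br (*s) (B61 \<alpha>)"
proof -
  obtain x y z where gen: "span ({x, y, z} \<union> L1) = UNIV" and yz: "br y z \<in> L2"
    using exists_commuting_generators assms(2,3) by blast
  define u where "u = br x y"
  define v where "v = br x z"
  define w where "w = br u v"
  have uL1: "u \<in> L1" and vL1: "v \<in> L1" by (simp_all only: u_def v_def br_in_lower_central_1)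
  have wL2: "w \<in> L2" unfolding w_def by (rule br_left_lower_central[OF uL1])
  note central = lower_central_central[OF L3]
  have L1: "L1 \<subseteq> span ({u, v} \<union> L2)"
  proof -
    have "{u, v, br y z} \<union> L2 \<subseteq> span ({u, v} \<union> L2)"
      using yz by (auto intro: span_base)
    then have "span ({u, v, br y z} \<union> L2) \<subseteq> span ({u, v} \<union> L2)"
      by (rule span_minimal) (rule subspace_span)
    then show ?thesis using three_generators_L1[OF gen] unfolding u_def v_def by blast
  qed
  have w0: "w \<noteq> 0"
  proof
    assume "w = 0"
    then have uv: "br u v = 0" "br v u = 0" using br_anticommute[of v u] by (simp_all add: w_def)
    have "br a b = 0" if "a \<in> L1" "b \<in> L1" for a b
    proof -
      have "br a b \<in> {0}"
      proof (rule br_in_subspace[of _ "{u, v} \<union> L2" "{u, v} \<union> L2"])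
        show "br a b \<in> {0}" if "a \<in> {u, v} \<union> L2" "b \<in> {u, v} \<union> L2" for a b
          using that uv by (elim UnE insertE emptyE) (simp_all add: central)
      qed (use that L1 in \<open>auto simp: subspace_single_0\<close>)
      then show ?thesis by simp
    qed
    then have "malcev_algebra scale br" by (rule malcev_if_L1_abelian[OF L3])
    with assms(1) show False by (rule notE)
  qed
  have L2: "L2 = span {w}"
  proof (rule sym, rule subspace_dim_equal)
    show "span {w} \<subseteq> L2" using wL2 by (intro span_minimal subspace_lower_central) simp
    show "dim L2 \<le> dim (span {w})" using w0 assms(3) by (simp add: dim_insert)
  qed (simp_all add: subspace_lower_central)
  have multiple: "\<exists>k. g = scale k w" if "g \<in> L2" for g
    using that unfolding L2 by (auto simp: span_singleton)
  \<comment> \<open>As [u, v] = \<open>w\<close> spans \<open>L2\<close>, the form on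
    \<open>L1/L2\<close> is nondegenerate: the action of \<open>a\<close> on \<open>u\<close> and
    \<open>v\<close> is cancelled by a combination of \<open>v\<close> and \<open>u\<close>.\<close>
  have shift: "\<exists>h. h \<in> L1 \<and> br (a + h) u = 0 \<and> br (a + h) v = 0" for a
  proof -
    obtain p q where p: "br a u = scale p w" and q: "br a v = scale q w"
      using multiple br_right_lower_central[OF uL1] br_right_lower_central[OF vL1] by metis
    have "br v u = - w" using br_anticommute[of v u] by (simp only: w_def)
    then have "br (a + (scale p v - scale q u)) u = 0" "br (a + (scale p v - scale q u)) v = 0"
      using p q by (simp_all add: br_linear w_def)
    moreover have "scale p v - scale q u \<in> L1" by (intro lower_central_closed uL1 vL1)
    ultimately show ?thesis by blast
  qed
  obtain g1 g2 g3 where g: "g1 \<in> L1" "g2 \<in> L1" "g3 \<in> L1"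
    and x': "br (x + g1) u = 0" "br (x + g1) v = 0"
    and y': "br (y + g2) u = 0" "br (y + g2) v = 0"
    and z': "br (z + g3) u = 0" "br (z + g3) v = 0"
    using shift[of x] shift[of y] shift[of z] by blast
  define e1 e2 e3 where "e1 = x + g1" and "e2 = y + g2" and "e3 = z + g3"
  define e4 e5 where "e4 = br e1 e2" and "e5 = br e1 e3"
  have LL: "br a b \<in> L2" "br b a \<in> L2" if "a \<in> L1" for a b
    using that by (rule br_left_lower_central, rule br_right_lower_central)
  \<comment> \<open>The corrections lie in \<open>L1\<close>, so they change products of generators
    only by central elements, and \<open>e4\<close>, \<open>e5\<close> multiply like
    \<open>u\<close>, \<open>v\<close>.\<close>
  have "e4 - u = br x g2 + br g1 (y + g2)" by (simp add: e4_def e1_def e2_def u_def br_linear)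
  also have "\<dots> \<in> L2" by (intro lower_central_closed LL g)
  finally have e4: "e4 - u \<in> L2" .
  have "e5 - v = br x g3 + br g1 (z + g3)" by (simp add: e5_def e1_def e3_def v_def br_linear)
  also have "\<dots> \<in> L2" by (intro lower_central_closed LL g)
  finally have e5: "e5 - v \<in> L2" .
  have "br e2 e3 = br y z + br y g3 + br g2 (z + g3)" by (simp add: e2_def e3_def br_linear)
  also have "\<dots> \<in> L2" by (intro lower_central_closed LL g yz)
  finally obtain \<alpha> where \<alpha>: "br e2 e3 = scale \<alpha> w" using multiple by blast
  have mod_e4: "br a e4 = br a u" "br e4 a = br u a" for a
    using central[OF e4] by (simp_all add: br_linear)
  have mod_e5: "br a e5 = br a v" "br e5 a = br v a" for a
    using central[OF e5] by (simp_all add: br_linear)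
  have cw: "br a w = 0" for a by (rule central[OF wL2])
  have prods: "br e1 e2 = e4" "br e1 e3 = e5" "br e4 e5 = w"
    by (simp_all only: e4_def[symmetric] e5_def[symmetric] mod_e4 mod_e5 w_def)
  have zeros: "br e1 e4 = 0" "br e1 e5 = 0" "br e2 e4 = 0" "br e2 e5 = 0" "br e3 e4 = 0" "br e3 e5 = 0"
    by (simp_all only: mod_e4 mod_e5) (simp_all only: e1_def e2_def e3_def x' y' z')
  have span: "span {e1, e2, e3, e4, e5, w} = UNIV"
  proof (rule span_eq_UNIV_trans)
    show "span ({e1, e2, e3} \<union> L1) = UNIV"
      by (rule span_shift_3[OF gen]) (use g in \<open>simp_all add: e1_def e2_def e3_def lower_central_closed\<close>)
    let ?Y = "{e1, e2, e3, e4, e5, w}"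
    have L2Y: "L2 \<subseteq> span ?Y" unfolding L2 by (rule span_mono) simp
    have base: "e1 \<in> span ?Y" "e2 \<in> span ?Y" "e3 \<in> span ?Y" "e4 \<in> span ?Y" "e5 \<in> span ?Y"
      by (simp_all add: span_base)
    have "u - e4 \<in> L2" "v - e5 \<in> L2"
      using lower_central_closed(4)[OF e4] lower_central_closed(4)[OF e5] by simp_all
    then have "u \<in> span ?Y" "v \<in> span ?Y"
      using L2Y base by (blast intro: in_span_cancel)+
    then have "span ({u, v} \<union> L2) \<subseteq> span ?Y"
      using L2Y by (intro span_minimal subspace_span) simp
    then show "{e1, e2, e3} \<union> L1 \<subseteq> span ?Y" using L1 base by simp
  qed
  have "alg_isomorphic scale br (*s) (B61 \<alpha>)"
    by (rule alg_isomorphic_B61[OF dim_UNIV_6 span]) (rule prods \<alpha> zeros cw)+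
  then show ?thesis by blast
qed

end

subsection \<open>Nilpotency class four\<close>

context nilpotent_binary_lie_6
begin

lemma isomorphic_B63_if_normal_form:
  assumes span: "span {e1, e2, e3, e4, e5, e6} = UNIV"
    and prods: "br e1 e2 = e3" "br e3 e4 = e5" "br e4 e5 = e6" "br e1 e3 = scale s e6" "br e2 e3 = scale t e6"
    and s: "s \<noteq> 0"
    and zeros: "br e1 e4 = 0" "br e1 e5 = 0" "br e1 e6 = 0" "br e2 e4 = 0" "br e2 e5 = 0"
      "br e2 e6 = 0" "br e3 e5 = 0" "br e3 e6 = 0" "br e4 e6 = 0" "br e5 e6 = 0"
  shows "alg_isomorphic scale br (*s) B63"
proof (rule alg_isomorphic_B63[OF dim_UNIV_6])
  \<comment> \<open>Subtracting the multiple of \<open>e1\<close> makes [e2, e3] zero; dividing by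
    \<open>s\<close> then turns [e1, e3] into the new \<open>e6\<close> and keeps the other
    products.\<close>
  let ?e1 = "scale (1 / s) e1" and ?e2 = "e2 - scale (t / s) e1" and ?e3 = "scale (1 / s) e3"
    and ?e5 = "scale (1 / s) e5" and ?e6 = "scale (1 / s) e6"
  show "span {?e1, ?e2, ?e3, e4, ?e5, ?e6} = UNIV" (is "span ?Y = _")
  proof (rule span_eq_UNIV_trans[OF span])
    have base: "?e1 \<in> span ?Y" "?e2 \<in> span ?Y" "?e3 \<in> span ?Y"
      "e4 \<in> span ?Y" "?e5 \<in> span ?Y" "?e6 \<in> span ?Y"
      by (simp_all add: span_base)
    have "v \<in> span ?Y" if "scale (1 / s) v \<in> span ?Y" for v
      using span_scale[OF that, of s] s by simp
    then have scaled: "e1 \<in> span ?Y" "e3 \<in> span ?Y" "e5 \<in> span ?Y" "e6 \<in> span ?Y"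
      using base by blast+
    moreover have "e2 \<in> span ?Y"
      by (rule in_span_cancel[of _ ?e2]) (use scaled(1) base(2) in \<open>simp_all add: span_scale\<close>)
    ultimately show "{e1, e2, e3, e4, e5, e6} \<subseteq> span ?Y" using base by simp
  qed
qed (use s in \<open>simp_all add: br_linear prods zeros\<close>)

lemma isomorphic_B62_B63_if_normal_form:
  assumes span: "span {e1, e2, e3, e4, e5, e6} = UNIV"
    and prods: "br e1 e2 = e3" "br e3 e4 = e5" "br e4 e5 = e6" "br e1 e3 = scale s e6" "br e2 e3 = scale t e6"
    and zeros: "br e1 e4 = 0" "br e1 e5 = 0" "br e1 e6 = 0" "br e2 e4 = 0" "br e2 e5 = 0"
      "br e2 e6 = 0" "br e3 e5 = 0" "br e3 e6 = 0" "br e4 e6 = 0" "br e5 e6 = 0"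
  shows "alg_isomorphic scale br (*s) B62 \<or> alg_isomorphic scale br (*s) B63"
proof -
  consider "s \<noteq> 0" | "t \<noteq> 0" | "s = 0" "t = 0" by blast
  then show ?thesis
  proof cases
    case 1
    then show ?thesis using isomorphic_B63_if_normal_form[OF span prods _ zeros] by blast
  next
    case 2
    \<comment> \<open>Exchanging \<open>e1\<close> and \<open>e2\<close> reverses the sign of
      \<open>e3\<close>, hence of \<open>e5\<close> and \<open>e6\<close>, and exchanges
      \<open>s\<close> and \<open>t\<close>.\<close>
    have span': "span {e2, e1, - e3, e4, - e5, - e6} = UNIV" (is "span ?Y = _")
    proof (rule span_eq_UNIV_trans[OF span])
      have base: "e1 \<in> span ?Y" "e2 \<in> span ?Y" "- e3 \<in> span ?Y"
        "e4 \<in> span ?Y" "- e5 \<in> span ?Y" "- e6 \<in> span ?Y"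
        by (simp_all add: span_base)
      then show "{e1, e2, e3, e4, e5, e6} \<subseteq> span ?Y"
        using span_neg[OF base(3)] span_neg[OF base(5)] span_neg[OF base(6)] by simp
    qed
    have "alg_isomorphic scale br (*s) B63"
      by (rule isomorphic_B63_if_normal_form[OF span', of t s])
        (use 2 in \<open>simp_all add: br_linear prods zeros br_anticommute[of e2 e1]\<close>)
    then show ?thesis by blast
  next
    case 3
    have "alg_isomorphic scale br (*s) B62"
      by (rule alg_isomorphic_B62[OF dim_UNIV_6 span]) (simp_all add: prods zeros 3)
    then show ?thesis by blast
  qed
qed

lemma isomorphic_B62_B63_if_generators:
  assumes nm: "\<not> malcev_algebra scale br"
    and dims: "dim L1 = 3" "dim L2 = 2" "dim L3 = 1" and L4: "L4 = {0}"
    and gen0: "span ({a0, b0, r0} \<union> L1) = UNIV" and ab0: "br a0 b0 \<notin> L2"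
  shows "alg_isomorphic scale br (*s) B62 \<or> alg_isomorphic scale br (*s) B63"
proof -
  note central = lower_central_central[OF L4]
  have LL1: "br x y \<in> L2" "br y x \<in> L2" if "x \<in> L1" for x y
    using that by (rule br_left_lower_central, rule br_right_lower_central)
  have LL2: "br x y \<in> L3" "br y x \<in> L3" if "x \<in> L2" for x y
    using that by (rule br_left_lower_central, rule br_right_lower_central)
  have L2_central: "br (br x y) z = 0" "br (br y x) z = 0" "br z (br x y) = 0" "br z (br y x) = 0"
    if "x \<in> L2" for x y z
    using central LL2[OF that] by blast+
  have L2L1: "x \<in> L1" if "x \<in> L2" for x using that lower_central_Suc_subset by blast

  define u where "u = br a0 b0"
  have uL1: "u \<in> L1" unfolding u_def by (rule br_in_lower_central_1)
  have L1: "span ({u} \<union> L2) = L1"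
    by (rule lower_central_eq_span_insert) (use dims uL1 ab0 in \<open>simp_all add: u_def\<close>)
  obtain s t where s: "br a0 r0 - scale s u \<in> L2" and t: "br b0 r0 - scale t u \<in> L2"
  proof -
    have "br a0 r0 \<in> span ({u} \<union> L2)" "br b0 r0 \<in> span ({u} \<union> L2)"
      unfolding L1 by (rule br_in_lower_central_1)+
    then show thesis using that by (metis span_cyclic_obtain)
  qed
  \<comment> \<open>\<open>r\<close> spans the radical of the alternating form on
    \<open>A/L1\<close> with values in \<open>L1/L2\<close>; the coefficients cancel the components
    of [a0, r0] and [b0, r0] along \<open>u\<close>.\<close>
  define r where "r = r0 - scale s b0 + scale t a0"
  have ar0: "br a0 r \<in> L2" using s by (simp add: r_def br_linear u_def)
  have br0: "br b0 r \<in> L2" using t by (simp add: r_def br_linear u_def br_anticommute[of b0 a0])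
  have gen1: "span ({a0, b0, r} \<union> L1) = UNIV" (is "span ?Y = _")
  proof (rule span_eq_UNIV_trans[OF gen0])
    have base: "a0 \<in> span ?Y" "b0 \<in> span ?Y" "r \<in> span ?Y" by (simp_all add: span_base)
    have "r0 \<in> span ?Y"
      by (rule in_span_cancel[of r0 r]) (use base in \<open>simp_all add: r_def span_scale span_diff\<close>)
    moreover have "L1 \<subseteq> span ?Y" using span_superset[of ?Y] by blast
    ultimately show "{a0, b0, r0} \<union> L1 \<subseteq> span ?Y" using base by simp
  qed

  have L2sq: "br x y = 0" if "x \<in> L2" "y \<in> L2" for x y
  proof -
    obtain p where p: "span ({p} \<union> L3) = L2"
      by (rule subspace_complement_1[OF subspace_lower_central subspace_lower_central
            lower_central_Suc_subset, of "Suc (Suc 0)"]) (use dims in simp_all)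
    have "br x y \<in> {0}"
    proof (rule br_in_subspace[of _ "{p} \<union> L3" "{p} \<union> L3"])
      show "br x y \<in> {0}" if "x \<in> {p} \<union> L3" "y \<in> {p} \<union> L3" for x y
        using that by (elim UnE insertE emptyE) (simp_all add: central)
    qed (use that p in \<open>simp_all add: subspace_single_0\<close>)
    then show ?thesis by simp
  qed
  \<comment> \<open>A swap turns J(x, y, [x, c]) into a Jacobian with \<open>c\<close> repeated. Its
    last two terms lie in \<open>L4\<close>, so the remaining term [c, [x, c]] vanishes too.\<close>
  have self_commuting: "br c (br x c) = 0" if c: "c = br x y" for x y c
  proof -
    have "jacobian x y (br x c) = - jacobian x c (br x y)" by (rule jacobian_br_swap)
    also have "\<dots> = 0" by (simp flip: c)
    finally have "jacobian x y (br x c) = 0" .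
    moreover have "c \<in> L1" unfolding c by (rule br_in_lower_central_1)
    then have "br x c \<in> L2" by (rule LL1)
    ultimately show ?thesis by (simp add: jacobian_def L2_central flip: c)
  qed
  have ua: "br u (br a0 u) = 0" by (rule self_commuting) (rule u_def)
  have "br (- u) (br b0 (- u)) = 0" by (rule self_commuting[of _ _ a0])
    (simp add: u_def br_anticommute[of b0 a0])
  then have ub: "br u (br b0 u) = 0" by (simp add: br_linear)
  \<comment> \<open>The previous fact is polarized: it is applied to [a0 + r, b0], which differs
    from \<open>u\<close> by an element of \<open>L2\<close>.\<close>
  have ur: "br u (br r u) = 0"
  proof -
    let ?h = "br r b0"
    have h: "?h \<in> L2" using lower_central_closed(4)[OF br0] by (simp add: br_anticommute[of r b0])
    have "br (u + ?h) (br (a0 + r) (u + ?h)) = 0"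
      by (rule self_commuting[of _ _ b0]) (simp add: u_def br_linear)
    moreover have "br ?h (br (a0 + r) (u + ?h)) = 0"
      by (rule L2sq[OF h]) (rule LL1, intro lower_central_closed uL1 L2L1[OF h])
    ultimately have "br u (br (a0 + r) (u + ?h)) = 0"
      by (simp only: br_add_left add_0_right)
    then show ?thesis using ua by (simp add: br_linear L2_central[OF h])
  qed
  have uL2: "br u x = 0" "br x u = 0" if "x \<in> L2" for x
  proof -
    \<comment> \<open>\<open>L2\<close> is spanned by products of \<open>u\<close> with generators,
      which commute with \<open>u\<close> by the three facts above, and by elements of the central
      \<open>L3\<close>.\<close>
    have "L2 \<subseteq> {x. br u x = 0}"
    proof (rule lower_central_Suc_minimal[of _ "{u} \<union> L2" "{a0, b0, r} \<union> L1"])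
      show "subspace {x. br u x = 0}" by (rule subspaceI) (simp_all add: br_linear)
      have 1: "br u (br u a0) = 0" "br u (br u b0) = 0" "br u (br u r) = 0"
        using ua ub ur unfolding br_anticommute[of u a0] br_anticommute[of u b0] br_anticommute[of u r]
        by (simp_all add: br_linear)
      have 2: "br u (br u y) = 0" if "y \<in> L1" for y
      proof -
        have "br u y \<in> L3"
        proof (rule br_in_subspace[OF subspace_lower_central, of "{u}" "{u} \<union> L2"])
          show "br a b \<in> L3" if "a \<in> {u}" "b \<in> {u} \<union> L2" for a b
            using that LL2 lower_central_closed(1) by (elim UnE insertE emptyE) simp_all
        qed (use that L1 in \<open>simp_all add: span_base\<close>)
        then show ?thesis by (rule central)
      qed
      show "br x y \<in> {x. br u x = 0}" if "x \<in> {u} \<union> L2" "y \<in> {a0, b0, r} \<union> L1" for x y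
        using that 1 2 by (elim UnE insertE emptyE) (simp_all add: L2_central)
    qed (use L1 gen1 in simp_all)
    then show "br u x = 0" using that by blast
    then show "br x u = 0" using br_anticommute[of x u] by simp
  qed
  have L1sq: "br x y = 0" if "x \<in> L1" "y \<in> L1" for x y
  proof -
    have "br x y \<in> {0}"
    proof (rule br_in_subspace[of _ "{u} \<union> L2" "{u} \<union> L2"])
      show "br x y \<in> {0}" if "x \<in> {u} \<union> L2" "y \<in> {u} \<union> L2" for x y
        using that by (elim UnE insertE emptyE) (simp_all add: uL2 L2sq)
    qed (use that L1 in \<open>simp_all add: subspace_single_0\<close>)
    then show ?thesis by simp
  qed

  have jac_L2: "jacobian x y h = 0" if "h \<in> L2" for x y h
    using L1sq[OF br_in_lower_central_1 L2L1[OF that]]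
    by (simp add: jacobian_def L2_central[OF that])
  have jac_abu: "jacobian a0 b0 u = 0" unfolding u_def by (rule jacobian_br_same)
  \<comment> \<open>Polarization again: [a0, b0 + r] is \<open>u\<close> up to an element of
    \<open>L2\<close>, where the Jacobian already vanishes.\<close>
  have jac_aru: "jacobian a0 r u = 0"
    using jacobian_br_same[of a0 "b0 + r"] jac_abu
    by (simp add: br_linear jacobian_add jac_L2[OF ar0] flip: u_def)
  have jac_bru: "jacobian b0 r u = 0"
    using jacobian_br_same[of b0 "a0 + r"] jacobian_perm_0(2)[OF jac_abu]
    by (simp add: br_linear jacobian_add jacobian_diff_right jac_L2[OF br0] br_anticommute[of b0 a0]
        flip: u_def)
  have jac_L1_u: "jacobian x y u = 0" "jacobian y x u = 0" if "x \<in> L1" for x y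
    using L1sq[OF LL1(1)[OF that, THEN L2L1] uL1] L1sq[OF LL1(2)[OF that, THEN L2L1] uL1]
      L1sq[OF LL1(1)[OF uL1, THEN L2L1] that] L1sq[OF LL1(2)[OF uL1, THEN L2L1] that]
      L1sq[OF uL1 that] L1sq[OF that uL1]
    by (simp_all add: jacobian_def)
  have jac_L1: "jacobian x y g = 0" if "g \<in> L1" for x y g
  proof -
    have "jacobian x y g \<in> {0}"
    proof (rule jacobian_in_subspace[of _ "{a0, b0, r} \<union> L1" "{a0, b0, r} \<union> L1" "{u} \<union> L2"])
      show "jacobian x y g \<in> {0}"
        if "x \<in> {a0, b0, r} \<union> L1" "y \<in> {a0, b0, r} \<union> L1" "g \<in> {u} \<union> L2" for x y g
        using that
        by (elim UnE insertE emptyE)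
          (simp_all add: jac_L2 jac_L1_u jac_abu jac_aru jac_bru jac_abu[THEN jacobian_perm_0(2)]
            jac_aru[THEN jacobian_perm_0(2)] jac_bru[THEN jacobian_perm_0(2)])
    qed (use that L1 gen1 in \<open>simp_all add: subspace_single_0\<close>)
    then show ?thesis by simp
  qed

  \<comment> \<open>Otherwise J(a0, b0, r), hence every Jacobian, lies in the central
    \<open>L3\<close>. As Jacobians with an argument in \<open>L1\<close> vanish, both sides of the
    Malcev identity would be zero.\<close>
  have urL3: "br u r \<notin> L3"
  proof
    assume ur3: "br u r \<in> L3"
    have jac_L1': "jacobian x g y = 0" "jacobian g x y = 0" if "g \<in> L1" for x y g
      using jacobian_perm_0[OF jac_L1[OF that]] by blast+
    have "jacobian a0 b0 r = br u r + br (br b0 r) a0 - br (br a0 r) b0"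
      by (simp add: jacobian_def u_def br_linear br_anticommute[of r a0])
    also have "\<dots> \<in> L3" by (intro lower_central_closed ur3 LL2 br0 ar0)
    finally have abr: "jacobian a0 b0 r \<in> L3" .
    then have nabr: "- jacobian a0 b0 r \<in> L3" by (rule lower_central_closed)
    have perms: "jacobian a0 r b0 = - jacobian a0 b0 r" "jacobian b0 a0 r = - jacobian a0 b0 r"
      "jacobian b0 r a0 = jacobian a0 b0 r" "jacobian r a0 b0 = jacobian a0 b0 r"
      "jacobian r b0 a0 = - jacobian a0 b0 r"
      by (rule jacobian_swap(2), rule jacobian_swap(1), rule jacobian_cycle, rule jacobian_cycle[symmetric],
          simp only: jacobian_swap(2)[of r b0 a0] jacobian_cycle[of a0 b0 r, symmetric])
    have jac: "jacobian x y z \<in> L3" for x y z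
    proof (rule jacobian_in_subspace[OF subspace_lower_central,
        of "{a0, b0, r} \<union> L1" "{a0, b0, r} \<union> L1" "{a0, b0, r} \<union> L1"])
      show "jacobian x y z \<in> L3"
        if "x \<in> {a0, b0, r} \<union> L1" "y \<in> {a0, b0, r} \<union> L1" "z \<in> {a0, b0, r} \<union> L1" for x y z
        using that abr nabr
        by (elim UnE insertE emptyE)
          (simp_all add: jac_L1 jac_L1' perms lower_central_closed(1))
    qed (simp_all only: gen1 UNIV_I)
    have "malcev_algebra scale br"
      by unfold_locales (simp add: jac_L1 br_in_lower_central_1 central[OF jac])
    with nm show False by (rule notE)
  qed

  have L2: "span ({v} \<union> L3) = L2" if "v \<in> L2" "v \<notin> L3" for v
    by (rule lower_central_eq_span_insert) (use dims that in simp_all)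
  obtain s1 t1 where s1: "br u a0 - scale s1 (br u r) \<in> L3" and t1: "br u b0 - scale t1 (br u r) \<in> L3"
  proof -
    have "br u a0 \<in> span ({br u r} \<union> L3)" "br u b0 \<in> span ({br u r} \<union> L3)"
      unfolding L2[OF LL1(1)[OF uL1] urL3] by (rule LL1(1)[OF uL1])+
    then show thesis using that by (metis span_cyclic_obtain)
  qed
  \<comment> \<open>[u, r] spans \<open>L2\<close> modulo \<open>L3\<close>, so subtracting
    multiples of \<open>r\<close> makes the generators act trivially on \<open>u\<close> modulo
    \<open>L3\<close>.\<close>
  define a where "a = a0 - scale s1 r"
  define b where "b = b0 - scale t1 r"
  have gen2: "span ({a, b, r} \<union> L1) = UNIV" (is "span ?Y = _")
  proof (rule span_eq_UNIV_trans[OF gen1])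
    have base: "a \<in> span ?Y" "b \<in> span ?Y" "r \<in> span ?Y" by (simp_all add: span_base)
    have "a0 \<in> span ?Y"
      by (rule in_span_cancel[of a0 a]) (use base in \<open>simp_all add: a_def span_scale\<close>)
    moreover have "b0 \<in> span ?Y"
      by (rule in_span_cancel[of b0 b]) (use base in \<open>simp_all add: b_def span_scale\<close>)
    moreover have "L1 \<subseteq> span ?Y" using span_superset[of ?Y] by blast
    ultimately show "{a0, b0, r} \<union> L1 \<subseteq> span ?Y" using base by simp
  qed
  have ar: "br a r \<in> L2" and br: "br b r \<in> L2" using ar0 br0 by (simp_all add: a_def b_def br_linear)
  define c where "c = br a b"
  have "c - u = - scale t1 (br a0 r) + scale s1 (br b0 r)"
    by (simp add: c_def u_def a_def b_def br_linear br_anticommute[of r b0])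
  also have "\<dots> \<in> L2" by (intro lower_central_closed ar0 br0)
  finally have cu: "c - u \<in> L2" .
  have c_mod: "br c x - br u x \<in> L3" for x
    using LL2(1)[OF cu, of x] by (simp only: br_diff_left)
  have ca: "br c a \<in> L3" and cb: "br c b \<in> L3"
  proof -
    have "br u a \<in> L3" "br u b \<in> L3" using s1 t1 by (simp_all add: a_def b_def br_linear)
    then show "br c a \<in> L3" "br c b \<in> L3"
      using lower_central_closed(2)[OF c_mod] by (metis diff_add_cancel)+
  qed
  define v where "v = br c r"
  have cL1: "c \<in> L1" unfolding c_def by (rule br_in_lower_central_1)
  have vL2: "v \<in> L2" unfolding v_def by (rule LL1(1)[OF cL1])
  have vL3: "v \<notin> L3"
  proof
    assume "v \<in> L3"
    from lower_central_closed(3)[OF this c_mod[of r]] urL3 show False by (simp add: v_def)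
  qed
  \<comment> \<open>With J(x, y, c) = 0 and [[x, y], c] = 0, the right multiplications by
    \<open>x\<close> and \<open>y\<close> commute on \<open>c\<close>. As [c, a] and [c, b] are
    central, \<open>a\<close> and \<open>b\<close> annihilate \<open>v\<close> = [c, r].\<close>
  have act: "br (br c x) y = br (br c y) x" for x y
  proof -
    have "jacobian x y c = 0" by (rule jac_L1[OF cL1])
    moreover have "br (br x y) c = 0" by (rule L1sq[OF br_in_lower_central_1 cL1])
    ultimately have "br (br y c) x + br (br c x) y = 0" by (simp add: jacobian_def)
    then show ?thesis unfolding br_anticommute[of y c] by (simp add: br_linear)
  qed
  have va: "br v a = 0" and vb: "br v b = 0"
    using act[of r a] act[of r b] central[OF ca] central[OF cb] by (simp_all add: v_def)
  define w where "w = br r v"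
  have vr: "br v r = - w" unfolding w_def by (rule br_anticommute)
  have wL3: "w \<in> L3" unfolding w_def by (rule LL2(2)[OF vL2])
  have L3: "L3 \<subseteq> span {w}"
  proof (rule lower_central_Suc_minimal[of _ "{v} \<union> L3" "{a, b, r} \<union> L1"])
    show "br x y \<in> span {w}" if "x \<in> {v} \<union> L3" "y \<in> {a, b, r} \<union> L1" for x y
    proof -
      have "br v y = 0" if "y \<in> L1" for y using L1sq[OF L2L1[OF vL2] that] .
      then show ?thesis
        using that by (elim UnE insertE emptyE)
          (simp_all add: va vb vr central span_zero span_neg span_base)
    qed
  qed (use L2[OF vL2 vL3] gen2 in simp_all)
  have multiple: "\<exists>k. g = scale k w" if "g \<in> L3" for g
    using that L3 by (auto simp: span_singleton)
  \<comment> \<open>[c, r] = \<open>v\<close> and [v, r] = -w, so a combination of \<open>c\<close>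
    and \<open>v\<close> cancels [x, r]. Its shape is recorded to control the new product of
    generators.\<close>
  have kill: "\<exists>h. h \<in> L1 \<and> br (x + h) r = 0 \<and> (\<exists>p q. h = scale q v - scale p c)"
    if x: "br x r \<in> L2" for x
  proof -
    have "br x r \<in> span ({v} \<union> L3)" using x L2[OF vL2 vL3] by simp
    then obtain p where "br x r - scale p v \<in> L3" by (rule span_cyclic_obtain)
    then obtain q where "br x r - scale p v = scale q w" using multiple by blast
    then have "br x r = scale p v + scale q w" by (simp add: diff_eq_eq add.commute)
    then have "br (x + (scale q v - scale p c)) r = 0" by (simp add: br_linear vr flip: v_def)
    moreover have "scale q v - scale p c \<in> L1" by (intro lower_central_closed cL1 L2L1[OF vL2])
    ultimately show ?thesis by blast
  qed
  obtain g p1 q1 where g: "g \<in> L1" "br (a + g) r = 0" "g = scale q1 v - scale p1 c"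
    using kill[OF ar] by blast
  obtain h p2 q2 where h: "h \<in> L1" "br (b + h) r = 0" "h = scale q2 v - scale p2 c"
    using kill[OF br] by blast
  define e1 e2 where "e1 = a + g" and "e2 = b + h"
  define e3 where "e3 = br e1 e2"
  have bv: "br a v = 0" "br b v = 0"
    using va vb br_anticommute[of a v] br_anticommute[of b v] by simp_all
  have ac: "br a c \<in> L3"
    using lower_central_closed(4)[OF ca] by (simp add: br_anticommute[of a c])
  \<comment> \<open>The \<open>v\<close> parts of \<open>g\<close> and \<open>h\<close> contribute
    nothing because \<open>a\<close> and \<open>b\<close> annihilate \<open>v\<close>; the
    \<open>c\<close> parts contribute only elements of \<open>L3\<close>.\<close>
  have "e3 - c = - scale p2 (br a c) - scale p1 (br c b)"
    using L1sq[OF g(1) h(1)] unfolding e3_def e1_def e2_def c_def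
    by (simp add: br_linear) (simp add: g(3) h(3) br_linear bv vb flip: c_def)
  also have "\<dots> \<in> L3" by (intro lower_central_closed ac cb)
  finally have e3c: "e3 - c \<in> L3" .
  have mod_e3: "br x e3 = br x c" "br e3 x = br c x" for x
    using central[OF e3c] by (simp_all add: br_linear)
  have "br e1 e3 \<in> L3" "br e2 e3 \<in> L3"
    unfolding mod_e3 using ac lower_central_closed(4)[OF cb] L1sq[OF g(1) cL1] L1sq[OF h(1) cL1]
    by (simp_all add: e1_def e2_def br_linear br_anticommute[of b c])
  then obtain \<sigma> \<tau> where st: "br e1 e3 = scale \<sigma> w" "br e2 e3 = scale \<tau> w"
    using multiple by metis
  show ?thesis
  proof (rule isomorphic_B62_B63_if_normal_form)
    show "br e1 e2 = e3" "br e3 r = v" "br r v = w" by (simp_all only: e3_def[symmetric] mod_e3 v_def w_def)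
    show "br e1 e3 = scale \<sigma> w" "br e2 e3 = scale \<tau> w" by (rule st)+
    show "br e1 r = 0" "br e2 r = 0" by (simp_all only: e1_def e2_def g(2) h(2))
    show "br e1 v = 0" "br e2 v = 0"
      using L1sq[OF g(1) L2L1[OF vL2]] L1sq[OF h(1) L2L1[OF vL2]]
      by (simp_all add: e1_def e2_def br_linear bv)
    show "br e1 w = 0" "br e2 w = 0" "br e3 w = 0" "br r w = 0" "br v w = 0"
      by (rule central[OF wL3])+
    show "br e3 v = 0" unfolding mod_e3 by (rule L1sq[OF cL1 L2L1[OF vL2]])
    show "span {e1, e2, e3, r, v, w} = UNIV" (is "span ?Y = _")
    proof (rule span_eq_UNIV_trans)
      show "span ({e1, e2, r} \<union> L1) = UNIV"
        by (rule span_shift_3[OF gen2])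
          (use g(1) h(1) in \<open>simp_all add: e1_def e2_def lower_central_closed\<close>)
      have base: "e1 \<in> span ?Y" "e2 \<in> span ?Y" "e3 \<in> span ?Y" "r \<in> span ?Y" "v \<in> span ?Y" "w \<in> span ?Y"
        by (simp_all add: span_base)
      have "span {w} \<subseteq> span ?Y" by (rule span_mono) simp
      then have L3Y: "L3 \<subseteq> span ?Y" using L3 by (rule order_trans[rotated])
      then have L2Y: "L2 \<subseteq> span ?Y"
        unfolding L2[OF vL2 vL3, symmetric] using base by (intro span_minimal subspace_span) simp
      have "u - e3 = - (e3 - c) - (c - u)" by (simp only: algebra_simps) simp
      also have "\<dots> \<in> span ?Y" by (rule span_diff[OF span_neg])
        (rule subsetD[OF L3Y e3c], rule subsetD[OF L2Y cu])
      finally have "u \<in> span ?Y" using base(3) by (rule in_span_cancel)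
      then have "L1 \<subseteq> span ?Y"
        unfolding L1[symmetric] using L2Y by (intro span_minimal subspace_span) simp
      then show "{e1, e2, r} \<union> L1 \<subseteq> span ?Y" using base by simp
    qed
  qed
qed

text \<open>Some two of three generators have a product outside \<open>L2\<close>; otherwise all of
  \<open>L1\<close> would lie in \<open>L2\<close>, against the dimensions.\<close>

lemma isomorphic_B62_B63:
  assumes nm: "\<not> malcev_algebra scale br"
    and dims: "dim L1 = 3" "dim L2 = 2" "dim L3 = 1" and L4: "L4 = {0}"
  shows "alg_isomorphic scale br (*s) B62 \<or> alg_isomorphic scale br (*s) B63"
proof -
  obtain x y z where gen: "span ({x, y, z} \<union> L1) = UNIV"
    using exists_three_generators[OF dims(1)] by blast
  note iso = isomorphic_B62_B63_if_generators[OF nm dims L4]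
  consider "br x y \<notin> L2" | "br x z \<notin> L2" | "br y z \<notin> L2"
    | "br x y \<in> L2" "br x z \<in> L2" "br y z \<in> L2" by blast
  then show ?thesis
  proof cases
    case 1
    then show ?thesis by (rule iso[OF gen])
  next
    case 2
    have "span ({x, z, y} \<union> L1) = UNIV" using gen by (simp add: insert_commute)
    then show ?thesis using 2 by (rule iso)
  next
    case 3
    have "span ({y, z, x} \<union> L1) = UNIV" using gen by (simp add: insert_commute)
    then show ?thesis using 3 by (rule iso)
  next
    case 4
    then have "span ({br x y, br x z, br y z} \<union> L2) \<subseteq> L2"
      by (intro span_minimal subspace_lower_central) simp
    then have "dim L1 \<le> dim L2"
      using three_generators_L1[OF gen] by (intro dim_subset) blast
    then show ?thesis using dims by simp
  qed
qed

lemma classification: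
  assumes "\<not> malcev_algebra scale br"
  shows "(\<exists>\<alpha>. alg_isomorphic scale br (*s) (B61 \<alpha>)) \<or>
    alg_isomorphic scale br (*s) B62 \<or> alg_isomorphic scale br (*s) B63"
  using non_malcev_dims(2)[OF assms]
proof (elim disjE conjE)
  assume "dim L2 = 1" "L3 = {0}"
  from isomorphic_B61[OF assms non_malcev_dims(1)[OF assms] this] show ?thesis by (rule disjI1)
next
  assume "dim L2 = 2" "dim L3 = 1" "L4 = {0}"
  from isomorphic_B62_B63[OF assms non_malcev_dims(1)[OF assms] this] show ?thesis by (rule disjI2)
qed

end

lemma binary_lie_6_classification:
  fixes scale :: "'a::field \<Rightarrow> 'b::ab_group_add \<Rightarrow> 'b"
  assumes "binary_lie_algebra scale br" "vector_space.dim scale (UNIV :: 'b set) = 6"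
    and "nonassoc_algebra.nilpotent scale br" "\<not> malcev_algebra scale br"
  shows "(\<exists>\<alpha>. alg_isomorphic scale br (*s) (B61 \<alpha>)) \<or>
    alg_isomorphic scale br (*s) B62 \<or> alg_isomorphic scale br (*s) B63"
proof -
  interpret binary_lie_algebra scale br by (rule assms(1))
  obtain B where B: "independent B" "span B = UNIV" "card B = 6"
    using basis_exists[of UNIV] assms(2) by (metis top.extremum_unique)
  \<comment> \<open>An infinite set has cardinality 0, so \<open>card B = 6\<close> makes the basis
    finite, as the locale requires.\<close>
  then have "finite B" by (simp add: card_ge_0_finite)
  then interpret nilpotent_binary_lie_6 scale br B
    using B assms(2,3) by unfold_locales simp_all
  show ?thesis by (rule classification[OF assms(4)])
qed

theorem theorem3:
  assumes "CHAR('a::field) \<noteq> 2"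
  shows
    "(\<forall>(scale :: 'a \<Rightarrow> 'b::ab_group_add \<Rightarrow> 'b) br.
        binary_lie_algebra scale br \<and>
        vector_space.dim scale (UNIV :: 'b set) = 6 \<and>
        nonassoc_algebra.nilpotent scale br \<and>
        \<not> malcev_algebra scale br \<longrightarrow>
          (\<exists>\<alpha>. alg_isomorphic scale br (*s) (B61 \<alpha>)) \<or>
          alg_isomorphic scale br (*s) B62 \<or>
          alg_isomorphic scale br (*s) B63) \<and>
     (\<forall>\<alpha> \<beta> :: 'a. alg_isomorphic (*s) (B61 \<alpha>) (*s) (B61 \<beta>) \<longleftrightarrow>
        (\<exists>l::'a. l \<noteq> 0 \<and> \<beta> = l ^ 2 * \<alpha>)) \<and>
     (\<forall>\<alpha> :: 'a. \<not> alg_isomorphic (*s) (B61 \<alpha>) (*s) B62) \<and>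
     (\<forall>\<alpha> :: 'a. \<not> alg_isomorphic (*s) (B61 \<alpha>) (*s) B63) \<and>
     \<not> alg_isomorphic (*s) (B62 :: 'a ^ 6 \<Rightarrow> _) (*s) B63"
  using binary_lie_6_classification B61_isomorphic_imp B61_isomorphic_scale
    B61_not_isomorphic_B62 B61_not_isomorphic_B63 B62_not_isomorphic_B63
  by blast

end
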